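(* Let $\Omega\subset\mathbb{R}^n$ be open with coordinates $u=(u^1,\dots,u^n)$, and let $\{r_1,\dots,r_n\}$ be a $C^2$-smooth rich frame on $\Omega$. Suppose $w=(w^1,\dots,w^n)=\rho(u)$ is a local coordinate system (Riemann coordinates) in which the frame is normalized so that $r_i=\partial/\partial w^i$ for $i=1,\dots,n$ (equivalently $r_j(w^i)\equiv\delta^i_j$), defined near a point $\bar w=(\bar w^1,\dots,\bar w^n)$. Let $Z^k_{ij}:=\Gamma^k_{ij}\circ\rho^{-1}$, and assume $Z^k_{ij}\equiv 0$ whenever $i,j,k$ are pairwise distinct. Then for any given functions $\varphi_1,\dots,\varphi_n$ of one variable (with $\varphi_i$ defined near $\bar w^i$), there is a unique local solution $\gamma^1(w),\dots,\gamma^n(w)$ near $\bar w$ of the system $$\frac{\partial \gamma^j}{\partial w^i}=Z^j_{ji}\,\gamma^j-Z^i_{jj}\,\gamma^i\qquad(1\le i\neq j\le n)$$ satisfying $$\gamma^i(\bar w^1,\dots,\bar w^{i-1},w^i,\bar w^{i+1},\dots,\bar w^n)=\varphi_i(w^i),\qquad i=1,\dots,n.$$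
   Context: A frame on $\Omega$ is a collection of smooth vector fields $r_1,\dots,r_n$ linearly independent at every point; in $u$-coordinates $r_i=\sum_k R_i^k(u)\,\partial/\partial u^k$. Let $R(u)=[R_1|\cdots|R_n]$ be the matrix with columns $R_i=(R_i^1,\dots,R_i^n)^T$, let $L(u)=R(u)^{-1}$ with rows $L^1,\dots,L^n$, and define $\Gamma^k_{ij}:=L^k\,(DR_j)\,R_i$ (where $DR_j$ is the $u$-Jacobian matrix of $R_j$) and $c^k_{ij}:=\Gamma^k_{ij}-\Gamma^k_{ji}$; then $[r_i,r_j]=\sum_k c^k_{ij}r_k$. The frame is called rich if $c^k_{ij}\equiv0$ whenever $i,j,k$ are pairwise distinct. Under the hypothesis $Z^k_{ij}\equiv0$ for pairwise distinct indices, the displayed PDE system is exactly the "$\beta$-system" of the frame written in the Riemann coordinates $w$, where $\gamma^i=\beta^i\circ\rho^{-1}$; the $\beta$-system expresses the condition that $L^T\,\mathrm{diag}[\beta^1,\dots,\beta^n]\,L$ is the $u$-Jacobian of some map (equivalently the Hessian of some scalar field $\eta$ for which the frame is orthogonal with respect to $D^2_u\eta$, with $\beta^i=R_i^TD^2_u\eta\,R_i$).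
   Formalization: The given functions φ_i are assumed continuously differentiable near w̄^i, and "solution" means a C^1 solution, with uniqueness among C^1 solutions on some neighbourhood of w̄; for arbitrary functions (e.g. a step function) no solution need exist. *)

theory Defs
  imports "HOL-Analysis.Analysis"
begin

definition C1_on :: "'a::real_normed_vector set \<Rightarrow> ('a \<Rightarrow> 'b::real_normed_vector) \<Rightarrow> bool" where
  "C1_on S f \<longleftrightarrow> (\<exists>f'. (\<forall>x\<in>S. (f has_derivative blinfun_apply (f' x)) (at x)) \<and> continuous_on S f')"

definition C2_on :: "'a::real_normed_vector set \<Rightarrow> ('a \<Rightarrow> 'b::real_normed_vector) \<Rightarrow> bool" where
  "C2_on S f \<longleftrightarrow> (\<exists>f'. (\<forall>x\<in>S. (f has_derivative blinfun_apply (f' x)) (at x)) \<and> C1_on S f')"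

definition frame_matrix :: "('n::finite \<Rightarrow> real^'n \<Rightarrow> real^'n) \<Rightarrow> real^'n \<Rightarrow> real^'n^'n" where
  "frame_matrix r u = (\<chi> k i. r i u $ k)"

definition is_frame :: "(real^'n::finite) set \<Rightarrow> ('n \<Rightarrow> real^'n \<Rightarrow> real^'n) \<Rightarrow> bool" where
  "is_frame \<Omega> r \<longleftrightarrow> (\<forall>u\<in>\<Omega>. invertible (frame_matrix r u))"

definition Gamma :: "('n::finite \<Rightarrow> real^'n \<Rightarrow> real^'n) \<Rightarrow> 'n \<Rightarrow> 'n \<Rightarrow> 'n \<Rightarrow> real^'n \<Rightarrow> real" where
  "Gamma r k i j u = (matrix_inv (frame_matrix r u) $ k) \<bullet> frechet_derivative (r j) (at u) (r i u)"

definition cstruct :: "('n::finite \<Rightarrow> real^'n \<Rightarrow> real^'n) \<Rightarrow> 'n \<Rightarrow> 'n \<Rightarrow> 'n \<Rightarrow> real^'n \<Rightarrow> real" where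
  "cstruct r k i j u = Gamma r k i j u - Gamma r k j i u"

definition rich_frame :: "(real^'n::finite) set \<Rightarrow> ('n \<Rightarrow> real^'n \<Rightarrow> real^'n) \<Rightarrow> bool" where
  "rich_frame \<Omega> r \<longleftrightarrow>
     (\<forall>u\<in>\<Omega>. \<forall>i j k. i \<noteq> j \<and> j \<noteq> k \<and> i \<noteq> k \<longrightarrow> cstruct r k i j u = 0)"

definition Zcoef :: "('n::finite \<Rightarrow> real^'n \<Rightarrow> real^'n) \<Rightarrow> (real^'n) set \<Rightarrow> (real^'n \<Rightarrow> real^'n)
    \<Rightarrow> 'n \<Rightarrow> 'n \<Rightarrow> 'n \<Rightarrow> real^'n \<Rightarrow> real" where
  "Zcoef r U \<rho> k i j w = Gamma r k i j (the_inv_into U \<rho> w)"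

definition beta_local_solution ::
  "('n::finite \<Rightarrow> 'n \<Rightarrow> 'n \<Rightarrow> real^'n \<Rightarrow> real) \<Rightarrow> real^'n \<Rightarrow> ('n \<Rightarrow> real set) \<Rightarrow> ('n \<Rightarrow> real \<Rightarrow> real)
     \<Rightarrow> (real^'n) set \<Rightarrow> ('n \<Rightarrow> real^'n \<Rightarrow> real) \<Rightarrow> bool" where
  "beta_local_solution Z wbar I \<phi> V \<gamma> \<longleftrightarrow>
     open V \<and> wbar \<in> V \<and> (\<forall>j. C1_on V (\<gamma> j)) \<and>
     (\<forall>w\<in>V. \<forall>i j. i \<noteq> j \<longrightarrow>
        ((\<lambda>t. \<gamma> j (w + t *\<^sub>R axis i 1)) has_real_derivative
            (Z j j i w * \<gamma> j w - Z i j j w * \<gamma> i w)) (at 0)) \<and>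
     (\<forall>i. \<forall>t\<in>I i. (\<chi> k. if k = i then t else wbar $ k) \<in> V \<longrightarrow>
        \<gamma> i (\<chi> k. if k = i then t else wbar $ k) = \<phi> i t)"

end

theory Submission
  imports Defs
begin

text \<open>
  In Riemann coordinates the frame fields are the coordinate fields \<open>P\<^sub>j = \<partial>\<^sub>j \<sigma>\<close> of \<open>\<sigma> = \<rho>\<^sup>-\<^sup>1\<close>, and
  \<open>\<partial>\<^sub>i P\<^sub>j = \<Sum>\<^sub>k Z\<^sup>k\<^sub>i\<^sub>j P\<^sub>k\<close>. Equality of the mixed second derivatives of \<open>\<sigma>\<close> and of \<open>P\<^sub>j\<close> makes \<open>Z\<close> symmetric
  in its lower indices and flat; when \<open>Z\<close> vanishes on pairwise distinct indices, flatness yields the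
  compatibility condition of the system. Each \<open>\<gamma>\<^sup>j\<close> is prescribed on the line through the base point in
  direction \<open>j\<close>, and on each hyperplane \<open>w\<^sup>j = const\<close> the system prescribes its differential. Integrating this
  differential along the segments from the line within the hyperplanes gives an integral equation whose Picard
  iteration converges in the C1 norm on small balls. By Poincare's homotopy formula, the error with which
  an iterate satisfies the equations is controlled by the curl of the prescribed differential, and
  compatibility expresses that curl linearly through the error of the previous iterate; so the errors
  tend to zero. Uniqueness follows from the mean value theorem along the same segments.
\<close>

section \<open>Continuously differentiable maps\<close>

text \<open>The derivative as a point of the normed space of bounded linear maps, so that its
  continuity and operator norm make sense. It carries information only where \<open>f\<close> is
  differentiable.\<close>

definition bderiv :: "('a::real_normed_vector \<Rightarrow> 'b::real_normed_vector) \<Rightarrow> 'a \<Rightarrow> 'a \<Rightarrow>\<^sub>L 'b" where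
  "bderiv f x = Blinfun (frechet_derivative f (at x))"

definition pd :: "'n::finite \<Rightarrow> (real^'n \<Rightarrow> 'b::real_normed_vector) \<Rightarrow> real^'n \<Rightarrow> 'b" where
  "pd i f w = bderiv f w (axis i 1)"

lemma bderiv_eqI:
  assumes "(f has_derivative blinfun_apply f') (at x)"
  shows "bderiv f x = f'"
  by (simp add: bderiv_def blinfun_apply_inverse flip: frechet_derivative_at[OF assms])

lemma has_derivative_blinfunI:
  assumes "(f has_derivative g) F" "\<And>h. g h = blinfun_apply f' h"
  shows "(f has_derivative blinfun_apply f') F"
proof -
  have "g = blinfun_apply f'" using assms(2) by (rule ext)
  with assms(1) show ?thesis by simp
qed

text \<open>Derivatives are unique, so the canonical \<open>bderiv\<close> can replace the
  existential witness in \<open>C1_on\<close>.\<close>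

lemma C1_on_bderiv:
  assumes "C1_on S f"
  shows "\<And>x. x \<in> S \<Longrightarrow> (f has_derivative blinfun_apply (bderiv f x)) (at x)"
    and "continuous_on S (bderiv f)"
proof -
  obtain f' where f': "\<And>x. x \<in> S \<Longrightarrow> (f has_derivative blinfun_apply (f' x)) (at x)"
    and c: "continuous_on S f'"
    using assms unfolding C1_on_def by blast
  have eq: "bderiv f x = f' x" if "x \<in> S" for x
    using bderiv_eqI[OF f'[OF that]] .
  show "\<And>x. x \<in> S \<Longrightarrow> (f has_derivative blinfun_apply (bderiv f x)) (at x)"
    using f' eq by simp
  show "continuous_on S (bderiv f)"
    using c eq by (simp cong: continuous_on_cong)
qed

lemma C1_onI:
  assumes "\<And>x. x \<in> S \<Longrightarrow> (f has_derivative blinfun_apply (f' x)) (at x)"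
    and "continuous_on S f'"
  shows "C1_on S f"
  using assms unfolding C1_on_def by blast

text \<open>\<open>bderiv f\<close> agrees with the witness only on \<open>S\<close>; openness turns
  this into agreement near each point, which transfers the derivative.\<close>

lemma C2_on_bderiv:
  assumes "C2_on S f" "open S"
  shows "C1_on S f" and "C1_on S (bderiv f)"
proof -
  obtain f' where f': "\<And>x. x \<in> S \<Longrightarrow> (f has_derivative blinfun_apply (f' x)) (at x)"
    and c: "C1_on S f'"
    using assms(1) unfolding C2_on_def by blast
  have eq: "bderiv f x = f' x" if "x \<in> S" for x
    using bderiv_eqI[OF f'[OF that]] .
  have "continuous_on S f'"
    by (intro continuous_at_imp_continuous_on ballI has_derivative_continuous[OF C1_on_bderiv(1)[OF c]])
  then show "C1_on S f" using f' by (rule C1_onI[rotated])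
  show "C1_on S (bderiv f)"
  proof (rule C1_onI)
    show "(bderiv f has_derivative blinfun_apply (bderiv f' x)) (at x)" if "x \<in> S" for x
      using C1_on_bderiv(1)[OF c that] \<open>open S\<close> that
      by (rule has_derivative_transform_within_open) (simp add: eq)
    show "continuous_on S (bderiv f')"
      by (rule C1_on_bderiv(2)[OF c])
  qed
qed

lemma C1_on_subset:
  assumes "C1_on S f" "T \<subseteq> S"
  shows "C1_on T f"
  by (rule C1_onI[OF C1_on_bderiv(1)[OF assms(1)] continuous_on_subset[OF C1_on_bderiv(2)[OF assms(1)] assms(2)]])
    (use assms(2) in auto)

lemma C1_on_imp_continuous_on: "C1_on S f \<Longrightarrow> continuous_on S f"
  by (intro continuous_at_imp_continuous_on ballI has_derivative_continuous[OF C1_on_bderiv(1)])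

lemma bderiv_cong:
  assumes "open S" "x \<in> S" "\<And>y. y \<in> S \<Longrightarrow> f y = g y" "C1_on S f"
  shows "bderiv g x = bderiv f x"
  by (rule bderiv_eqI, rule has_derivative_transform_within_open[OF C1_on_bderiv(1)[OF assms(4,2)] assms(1,2)])
    (simp add: assms(3))

lemma C1_on_cong:
  assumes "open S" "\<And>y. y \<in> S \<Longrightarrow> f y = g y" "C1_on S f"
  shows "C1_on S g"
  by (rule C1_onI[OF _ C1_on_bderiv(2)[OF assms(3)]],
      rule has_derivative_transform_within_open[OF C1_on_bderiv(1)[OF assms(3)] assms(1)])
    (simp_all add: assms(2))

lemma C1_on_const: "C1_on S (\<lambda>x. c)"
  by (rule C1_onI[where f' = "\<lambda>x. 0"]) (auto simp: zero_blinfun.rep_eq)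

lemma bderiv_const: "bderiv (\<lambda>x. c) x = 0"
  by (rule bderiv_eqI) (auto simp: zero_blinfun.rep_eq)

lemma C1_on_blinfun: "C1_on S (blinfun_apply L)"
  by (rule C1_onI[where f' = "\<lambda>x. L"]) (auto intro: bounded_linear_imp_has_derivative blinfun.bounded_linear_right)

lemma has_derivative_blinfun_sum:
  assumes "\<And>i. i \<in> A \<Longrightarrow> (f i has_derivative blinfun_apply (f' i)) (at x)"
  shows "((\<lambda>x. \<Sum>i\<in>A. f i x) has_derivative blinfun_apply (\<Sum>i\<in>A. f' i)) (at x)"
  by (rule has_derivative_blinfunI[OF has_derivative_sum[OF assms]]) (simp_all add: blinfun.sum_left)

lemma has_derivative_blinfun_diff:
  assumes "(f has_derivative blinfun_apply f') (at x)" "(g has_derivative blinfun_apply g') (at x)"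
  shows "((\<lambda>x. f x - g x) has_derivative blinfun_apply (f' - g')) (at x)"
  by (rule has_derivative_blinfunI[OF has_derivative_diff[OF assms]]) (simp add: blinfun.diff_left)

lemma has_derivative_blinfun_add:
  assumes "(f has_derivative blinfun_apply f') (at x)" "(g has_derivative blinfun_apply g') (at x)"
  shows "((\<lambda>x. f x + g x) has_derivative blinfun_apply (f' + g')) (at x)"
  by (rule has_derivative_blinfunI[OF has_derivative_add[OF assms]]) (simp add: blinfun.add_left)

lemma C1_on_sum:
  assumes "\<And>i. i \<in> A \<Longrightarrow> C1_on S (f i)"
  shows "C1_on S (\<lambda>x. \<Sum>i\<in>A. f i x)"
proof (rule C1_onI)
  show "((\<lambda>x. \<Sum>i\<in>A. f i x) has_derivative blinfun_apply (\<Sum>i\<in>A. bderiv (f i) x)) (at x)" if "x \<in> S" for x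
    by (intro has_derivative_blinfun_sum C1_on_bderiv(1)[OF assms that])
  show "continuous_on S (\<lambda>x. \<Sum>i\<in>A. bderiv (f i) x)"
    by (intro continuous_on_sum C1_on_bderiv(2) assms)
qed

lemma bderiv_sum:
  assumes "\<And>i. i \<in> A \<Longrightarrow> C1_on S (f i)" "x \<in> S"
  shows "bderiv (\<lambda>x. \<Sum>i\<in>A. f i x) x = (\<Sum>i\<in>A. bderiv (f i) x)"
  by (intro bderiv_eqI has_derivative_blinfun_sum C1_on_bderiv(1)[OF assms])

lemma C1_on_diff:
  assumes "C1_on S f" "C1_on S g"
  shows "C1_on S (\<lambda>x. f x - g x)"
  by (rule C1_onI[OF has_derivative_blinfun_diff[OF C1_on_bderiv(1)[OF assms(1)] C1_on_bderiv(1)[OF assms(2)]]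
        continuous_on_diff[OF C1_on_bderiv(2)[OF assms(1)] C1_on_bderiv(2)[OF assms(2)]]])

lemma bderiv_diff:
  assumes "C1_on S f" "C1_on S g" "x \<in> S"
  shows "bderiv (\<lambda>x. f x - g x) x = bderiv f x - bderiv g x"
  by (intro bderiv_eqI has_derivative_blinfun_diff C1_on_bderiv(1)[OF _ assms(3)] assms)

lemma C1_on_add:
  assumes "C1_on S f" "C1_on S g"
  shows "C1_on S (\<lambda>x. f x + g x)"
  by (rule C1_onI[OF has_derivative_blinfun_add[OF C1_on_bderiv(1)[OF assms(1)] C1_on_bderiv(1)[OF assms(2)]]
        continuous_on_add[OF C1_on_bderiv(2)[OF assms(1)] C1_on_bderiv(2)[OF assms(2)]]])

lemma bderiv_add:
  assumes "C1_on S f" "C1_on S g" "x \<in> S"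
  shows "bderiv (\<lambda>x. f x + g x) x = bderiv f x + bderiv g x"
  by (intro bderiv_eqI has_derivative_blinfun_add C1_on_bderiv(1)[OF _ assms(3)] assms)

lemma C1_on_uminus:
  assumes "C1_on S f"
  shows "C1_on S (\<lambda>x. - f x)"
  using C1_on_diff[OF C1_on_const[where c = 0] assms] by simp

lemma bderiv_uminus:
  assumes "C1_on S f" "x \<in> S"
  shows "bderiv (\<lambda>x. - f x) x = - bderiv f x"
  using bderiv_diff[OF C1_on_const[where c = 0] assms] by (simp add: bderiv_const)

lemma has_derivative_blinfun_compose:
  assumes "(f has_derivative blinfun_apply f') (at x)" "(g has_derivative blinfun_apply g') (at (f x))"
  shows "((\<lambda>x. g (f x)) has_derivative blinfun_apply (g' o\<^sub>L f')) (at x)"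
  by (rule has_derivative_blinfunI[OF has_derivative_compose[OF assms]]) simp

lemma C1_on_compose:
  assumes "C1_on S f" "C1_on T g" "f ` S \<subseteq> T"
  shows "C1_on S (\<lambda>x. g (f x))"
proof (rule C1_onI)
  show "((\<lambda>x. g (f x)) has_derivative blinfun_apply (bderiv g (f x) o\<^sub>L bderiv f x)) (at x)" if "x \<in> S" for x
    using that assms by (intro has_derivative_blinfun_compose C1_on_bderiv(1)) auto
  show "continuous_on S (\<lambda>x. bderiv g (f x) o\<^sub>L bderiv f x)"
    by (intro continuous_intros continuous_on_compose2[OF C1_on_bderiv(2)[OF assms(2)] _ assms(3)]
        C1_on_imp_continuous_on[OF assms(1)] C1_on_bderiv(2)[OF assms(1)])
qed

lemma bderiv_compose:
  assumes "C1_on S f" "C1_on T g" "f x \<in> T" "x \<in> S"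
  shows "bderiv (\<lambda>x. g (f x)) x = bderiv g (f x) o\<^sub>L bderiv f x"
  by (intro bderiv_eqI has_derivative_blinfun_compose C1_on_bderiv(1)) (use assms in auto)

section \<open>Product rules, components, inverses and determinants\<close>

context bounded_bilinear
begin

lemma has_derivative_blinfun_prod:
  assumes "(f has_derivative blinfun_apply f') (at x)" "(g has_derivative blinfun_apply g') (at x)"
  shows "((\<lambda>x. prod (f x) (g x)) has_derivative
    blinfun_apply ((prod_right (f x) o\<^sub>L g') + (prod_left (g x) o\<^sub>L f'))) (at x)"
  by (rule has_derivative_blinfunI[OF FDERIV[OF assms]]) (simp add: blinfun.add_left)

lemma C1_on_prod:
  assumes "C1_on S f" "C1_on S g"
  shows "C1_on S (\<lambda>x. prod (f x) (g x))"
proof (rule C1_onI)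
  show "((\<lambda>x. prod (f x) (g x)) has_derivative
    blinfun_apply ((prod_right (f x) o\<^sub>L bderiv g x) + (prod_left (g x) o\<^sub>L bderiv f x))) (at x)" if "x \<in> S" for x
    by (rule has_derivative_blinfun_prod[OF C1_on_bderiv(1)[OF assms(1) that] C1_on_bderiv(1)[OF assms(2) that]])
  show "continuous_on S (\<lambda>x. (prod_right (f x) o\<^sub>L bderiv g x) + (prod_left (g x) o\<^sub>L bderiv f x))"
    by (intro continuous_on_add bounded_bilinear.continuous_on[OF bounded_bilinear_blinfun_compose]
       bounded_linear.continuous_on[OF bounded_linear_prod_right]
       bounded_linear.continuous_on[OF bounded_linear_prod_left]
        C1_on_imp_continuous_on[OF assms(1)] C1_on_imp_continuous_on[OF assms(2)]
        C1_on_bderiv(2)[OF assms(1)] C1_on_bderiv(2)[OF assms(2)])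
qed

lemma bderiv_prod:
  assumes "C1_on S f" "C1_on S g" "x \<in> S"
  shows "bderiv (\<lambda>x. prod (f x) (g x)) x = (prod_right (f x) o\<^sub>L bderiv g x) + (prod_left (g x) o\<^sub>L bderiv f x)"
  by (rule bderiv_eqI[OF has_derivative_blinfun_prod[OF C1_on_bderiv(1)[OF assms(1,3)] C1_on_bderiv(1)[OF assms(2,3)]]])

end

lemmas C1_on_mult = bounded_bilinear.C1_on_prod[OF bounded_bilinear_mult]
lemmas C1_on_blinfun_apply = bounded_bilinear.C1_on_prod[OF bounded_bilinear_blinfun_apply]

lemma has_derivative_blinfun_vec_nth:
  assumes "(f has_derivative blinfun_apply f') (at x)"
  shows "((\<lambda>x. f x $ i) has_derivative blinfun_apply (Blinfun (\<lambda>v. v $ i) o\<^sub>L f')) (at x)"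
  by (rule has_derivative_blinfunI[OF bounded_linear.has_derivative[OF bounded_linear_vec_nth assms]])
    (simp add: bounded_linear_Blinfun_apply bounded_linear_vec_nth)

lemma C1_on_vec_nth:
  assumes "C1_on S f"
  shows "C1_on S (\<lambda>x. f x $ i)"
proof (rule C1_onI[OF has_derivative_blinfun_vec_nth[OF C1_on_bderiv(1)[OF assms]]])
  show "continuous_on S (\<lambda>x. Blinfun (\<lambda>v. v $ i) o\<^sub>L bderiv f x)"
    by (intro bounded_bilinear.continuous_on[OF bounded_bilinear_blinfun_compose] continuous_on_const
        C1_on_bderiv(2)[OF assms])
qed

lemma pd_vec_nth:
  assumes "C1_on S f" "x \<in> S"
  shows "pd j (\<lambda>x. f x $ i) x = pd j f x $ i"
  using bderiv_eqI[OF has_derivative_blinfun_vec_nth[OF C1_on_bderiv(1)[OF assms]]]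
  by (simp add: pd_def bounded_linear_Blinfun_apply bounded_linear_vec_nth)

lemma C1_on_prod_set:
  fixes f :: "'i \<Rightarrow> 'a::real_normed_vector \<Rightarrow> real"
  assumes "finite A" "\<And>i. i \<in> A \<Longrightarrow> C1_on S (f i)"
  shows "C1_on S (\<lambda>x. \<Prod>i\<in>A. f i x)"
  using assms
proof (induction A rule: finite_induct)
  case empty
  then show ?case by (simp add: C1_on_const)
next
  case (insert a A)
  then have "C1_on S (\<lambda>x. f a x * (\<Prod>i\<in>A. f i x))"
    by (intro C1_on_mult) simp_all
  with insert.hyps show ?case by simp
qed

lemma C1_on_inverse:
  fixes f :: "'a::real_normed_vector \<Rightarrow> real"
  assumes "C1_on S f" "\<And>x. x \<in> S \<Longrightarrow> f x \<noteq> 0"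
  shows "C1_on S (\<lambda>x. inverse (f x))"
proof (rule C1_onI)
  show "((\<lambda>x. inverse (f x)) has_derivative
      blinfun_apply (- ((inverse (f x) * inverse (f x)) *\<^sub>R bderiv f x))) (at x)" if "x \<in> S" for x
    by (rule has_derivative_blinfunI[OF Deriv.has_derivative_inverse[OF assms(2)[OF that] C1_on_bderiv(1)[OF assms(1) that]]])
      (simp add: blinfun.minus_left blinfun.scaleR_left mult_ac)
  have "continuous_on S (\<lambda>x. inverse (f x))"
    using continuous_on_inverse[OF C1_on_imp_continuous_on[OF assms(1)]] assms(2) by blast
  then show "continuous_on S (\<lambda>x. - ((inverse (f x) * inverse (f x)) *\<^sub>R bderiv f x))"
    by (intro continuous_on_minus continuous_on_scaleR continuous_on_mult C1_on_bderiv(2)[OF assms(1)])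
qed

text \<open>The Leibniz formula makes the determinant a polynomial in the entries.\<close>

lemma C1_on_det:
  fixes A :: "'a::real_normed_vector \<Rightarrow> real^'n^'n::finite"
  assumes "\<And>i j. C1_on S (\<lambda>x. A x $ i $ j)"
  shows "C1_on S (\<lambda>x. det (A x))"
proof -
  have "C1_on S (\<lambda>x. of_int (sign p) * (\<Prod>i\<in>UNIV. A x $ i $ p i))" for p
    by (rule C1_on_mult[OF C1_on_const C1_on_prod_set]) (simp_all add: assms)
  then show ?thesis
    unfolding det_def by (rule C1_on_sum)
qed

section \<open>Partial derivatives and derivatives along coordinate lines\<close>

lemma pd_eqI:
  assumes "(f has_derivative f') (at w)"
  shows "pd i f w = f' (axis i 1)"
  using assms bderiv_eqI[of f "Blinfun f'" w] has_derivative_bounded_linear[OF assms]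
  by (simp add: pd_def bounded_linear_Blinfun_apply)

lemma pd_mult:
  fixes f g :: "real^'n::finite \<Rightarrow> real"
  assumes "C1_on S f" "C1_on S g" "x \<in> S"
  shows "pd i (\<lambda>x. f x * g x) x = f x * pd i g x + pd i f x * g x"
  by (simp add: pd_def bounded_bilinear.bderiv_prod[OF bounded_bilinear_mult assms] blinfun.add_left
      bounded_bilinear.prod_left.rep_eq[OF bounded_bilinear_mult] bounded_bilinear.prod_right.rep_eq[OF bounded_bilinear_mult])

lemma pd_sum:
  assumes "\<And>k. k \<in> A \<Longrightarrow> C1_on S (f k)" "x \<in> S"
  shows "pd i (\<lambda>x. \<Sum>k\<in>A. f k x) x = (\<Sum>k\<in>A. pd i (f k) x)"
  unfolding pd_def by (subst bderiv_sum[OF assms]) (auto simp: blinfun.sum_left)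

lemma pd_cong:
  assumes "open S" "x \<in> S" "\<And>y. y \<in> S \<Longrightarrow> f y = g y" "C1_on S f"
  shows "pd i g x = pd i f x"
  unfolding pd_def by (simp add: bderiv_cong[OF assms])

text \<open>Bridge between total derivatives and the one-dimensional derivatives used by the mean
  value theorem and by \<open>beta_local_solution\<close>.\<close>

lemma pd_has_real_derivative_line:
  fixes f :: "real^'n::finite \<Rightarrow> real"
  assumes "C1_on S f" "x + s *\<^sub>R axis i 1 \<in> S"
  shows "((\<lambda>t. f (x + t *\<^sub>R axis i 1)) has_real_derivative pd i f (x + s *\<^sub>R axis i 1)) (at s)"
proof -
  have "((\<lambda>t::real. x + t *\<^sub>R axis i 1) has_derivative (\<lambda>t. t *\<^sub>R axis i 1)) (at s)"
    by (auto intro!: derivative_eq_intros)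
  from has_derivative_compose[OF this C1_on_bderiv(1)[OF assms]]
  have "((\<lambda>t. f (x + t *\<^sub>R axis i 1)) has_derivative
    (\<lambda>t. bderiv f (x + s *\<^sub>R axis i 1) (t *\<^sub>R axis i 1))) (at s)" .
  moreover have "(\<lambda>t. bderiv f (x + s *\<^sub>R axis i 1) (t *\<^sub>R axis i 1)) = (*) (pd i f (x + s *\<^sub>R axis i 1))"
    by (rule ext) (simp add: pd_def blinfun.scaleR_right mult.commute)
  ultimately show ?thesis
    by (simp only: has_field_derivative_def)
qed

section \<open>Symmetry of second derivatives and flatness\<close>

text \<open>The second difference is the increment in direction \<open>i\<close> of the increment in
  direction \<open>j\<close>; the mean value theorem is applied first along \<open>i\<close>, then
  along \<open>j\<close> to \<open>pd i f\<close>.\<close>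

lemma second_difference_mean_value:
  fixes f :: "real^'n::finite \<Rightarrow> real"
  assumes f: "C1_on S f" "C1_on S (pd i f)" and ball: "ball w \<rho> \<subseteq> S" and h: "0 < h" "2 * h < \<rho>"
  shows "\<exists>x\<in>ball w \<rho>. f (w + h *\<^sub>R axis i 1 + h *\<^sub>R axis j 1) - f (w + h *\<^sub>R axis i 1)
      - f (w + h *\<^sub>R axis j 1) + f w = h * h * pd j (pd i f) x"
proof -
  have near: "w + s *\<^sub>R axis i 1 + t *\<^sub>R axis j 1 \<in> ball w \<rho>" if "0 \<le> s" "s \<le> h" "0 \<le> t" "t \<le> h" for s t
  proof -
    have "norm (s *\<^sub>R axis i 1 + t *\<^sub>R axis j 1 :: real^'n) \<le> s + t"
      using norm_triangle_ineq[of "s *\<^sub>R axis i 1 :: real^'n" "t *\<^sub>R axis j 1"] that by simp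
    moreover have "dist w (w + v) = norm v" for v :: "real^'n"
      by (simp add: dist_norm)
    ultimately show ?thesis
      using that h by (simp add: add.assoc)
  qed
  then have inS: "w + s *\<^sub>R axis i 1 + t *\<^sub>R axis j 1 \<in> S" if "0 \<le> s" "s \<le> h" "0 \<le> t" "t \<le> h" for s t
    using that ball by blast
  let ?e = "axis i 1 :: real^'n" and ?e' = "axis j 1 :: real^'n"
  let ?\<phi> = "\<lambda>s. f (w + h *\<^sub>R ?e' + s *\<^sub>R ?e) - f (w + s *\<^sub>R ?e)"
  have "\<exists>z. 0 < z \<and> z < h \<and> ?\<phi> h - ?\<phi> 0 = (h - 0) * (pd i f (w + h *\<^sub>R ?e' + z *\<^sub>R ?e) - pd i f (w + z *\<^sub>R ?e))"
  proof (rule MVT2[OF h(1)])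
    fix s :: real assume s: "0 \<le> s" "s \<le> h"
    have "w + h *\<^sub>R ?e' + s *\<^sub>R ?e \<in> S"
      using inS[OF s, of h] h by (simp add: algebra_simps)
    moreover have "w + s *\<^sub>R ?e \<in> S"
      using inS[OF s, of 0] h by simp
    ultimately show "(?\<phi> has_real_derivative (pd i f (w + h *\<^sub>R ?e' + s *\<^sub>R ?e) - pd i f (w + s *\<^sub>R ?e))) (at s)"
      by (intro DERIV_diff pd_has_real_derivative_line[OF f(1)])
  qed
  then obtain z where z: "0 < z" "z < h"
    and zeq: "?\<phi> h - ?\<phi> 0 = h * (pd i f (w + h *\<^sub>R ?e' + z *\<^sub>R ?e) - pd i f (w + z *\<^sub>R ?e))"
    by auto
  let ?\<psi> = "\<lambda>t. pd i f (w + z *\<^sub>R ?e + t *\<^sub>R ?e')"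
  have "\<exists>y. 0 < y \<and> y < h \<and> ?\<psi> h - ?\<psi> 0 = (h - 0) * pd j (pd i f) (w + z *\<^sub>R ?e + y *\<^sub>R ?e')"
  proof (rule MVT2[OF h(1)])
    fix t :: real assume "0 \<le> t" "t \<le> h"
    then show "(?\<psi> has_real_derivative pd j (pd i f) (w + z *\<^sub>R ?e + t *\<^sub>R ?e')) (at t)"
      using z by (intro pd_has_real_derivative_line[OF f(2)] inS) auto
  qed
  then obtain y where y: "0 < y" "y < h"
    and yeq: "?\<psi> h - ?\<psi> 0 = h * pd j (pd i f) (w + z *\<^sub>R ?e + y *\<^sub>R ?e')"
    by auto
  have "?\<phi> h - ?\<phi> 0 = h * (?\<psi> h - ?\<psi> 0)"
    using zeq by (simp add: add.assoc add.commute[of "h *\<^sub>R ?e'"])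
  then have "?\<phi> h - ?\<phi> 0 = h * h * pd j (pd i f) (w + z *\<^sub>R ?e + y *\<^sub>R ?e')"
    using yeq by simp
  moreover have "?\<phi> h - ?\<phi> 0 = f (w + h *\<^sub>R ?e + h *\<^sub>R ?e') - f (w + h *\<^sub>R ?e)
      - f (w + h *\<^sub>R ?e') + f w"
    by (simp add: add.assoc add.commute[of "h *\<^sub>R ?e'"])
  ultimately show ?thesis
    using near[of z y] z y by (intro bexI[of _ "w + z *\<^sub>R ?e + y *\<^sub>R ?e'"]) auto
qed

text \<open>Schwarz's theorem: the second difference is symmetric in \<open>i\<close> and
  \<open>j\<close>, so the two mixed derivatives share a value at two points of an arbitrarily small
  ball, and continuity carries this to \<open>w\<close>.\<close>

lemma pd_pd_commute:
  fixes f :: "real^'n::finite \<Rightarrow> real"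
  assumes S: "open S" "w \<in> S" and f: "C1_on S f" "C1_on S (pd i f)" "C1_on S (pd j f)"
  shows "pd j (pd i f) w = pd i (pd j f) w"
proof -
  have cont: "continuous_on S (pd k g)" if "C1_on S g" for k and g :: "real^'n \<Rightarrow> real"
  proof -
    have "continuous_on S (\<lambda>x. bderiv g x (axis k 1))"
      by (intro continuous_intros C1_on_bderiv(2)[OF that])
    then show ?thesis by (simp add: pd_def[abs_def])
  qed
  have "\<bar>pd j (pd i f) w - pd i (pd j f) w\<bar> \<le> e" if "e > 0" for e
  proof -
    have "isCont (pd j (pd i f)) w" "isCont (pd i (pd j f)) w"
      using cont[OF f(2), of j] cont[OF f(3), of i] S by (auto simp: continuous_on_eq_continuous_at)
    moreover have "e / 2 > 0" using that by simp
    ultimately obtain d1 d2 where d: "d1 > 0" "d2 > 0"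
      and d1: "\<And>x. dist x w < d1 \<Longrightarrow> dist (pd j (pd i f) x) (pd j (pd i f) w) < e / 2"
      and d2: "\<And>x. dist x w < d2 \<Longrightarrow> dist (pd i (pd j f) x) (pd i (pd j f) w) < e / 2"
      unfolding continuous_at_eps_delta by blast
    obtain d3 where d3: "d3 > 0" "ball w d3 \<subseteq> S"
      using S openE by blast
    define \<rho> where "\<rho> = min d1 (min d2 d3)"
    have \<rho>: "\<rho> > 0" "ball w \<rho> \<subseteq> S"
      using d d3 by (auto simp: \<rho>_def)
    \<comment> \<open>Side of the square spanned by the second difference;
      \<open>2 * h < \<rho>\<close> keeps the square inside the ball.\<close>
    define h where "h = \<rho> / 3"
    have h: "0 < h" "2 * h < \<rho>" using \<rho> by (auto simp: h_def)
    obtain x where x: "x \<in> ball w \<rho>" "f (w + h *\<^sub>R axis i 1 + h *\<^sub>R axis j 1) - f (w + h *\<^sub>R axis i 1)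
      - f (w + h *\<^sub>R axis j 1) + f w = h * h * pd j (pd i f) x"
      using second_difference_mean_value[OF f(1,2) \<rho>(2) h] by blast
    obtain y where y: "y \<in> ball w \<rho>" "f (w + h *\<^sub>R axis j 1 + h *\<^sub>R axis i 1) - f (w + h *\<^sub>R axis j 1)
      - f (w + h *\<^sub>R axis i 1) + f w = h * h * pd i (pd j f) y"
      using second_difference_mean_value[OF f(1,3) \<rho>(2) h] by blast
    have "w + h *\<^sub>R axis j 1 + h *\<^sub>R axis i 1 = w + h *\<^sub>R axis i 1 + h *\<^sub>R axis j 1"
      by (simp add: algebra_simps)
    then have "h * h * pd j (pd i f) x = h * h * pd i (pd j f) y"
      unfolding x(2)[symmetric] y(2)[symmetric] by (simp only: diff_add_eq diff_diff_eq add.commute add.left_commute)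
    then have "pd j (pd i f) x = pd i (pd j f) y"
      using h by simp
    moreover have "dist (pd j (pd i f) x) (pd j (pd i f) w) < e / 2"
      using x(1) by (intro d1) (auto simp: \<rho>_def dist_commute)
    moreover have "dist (pd i (pd j f) y) (pd i (pd j f) w) < e / 2"
      using y(1) by (intro d2) (auto simp: \<rho>_def dist_commute)
    ultimately show ?thesis
      by (simp add: dist_real_def abs_if split: if_splits)
  qed
  then have "\<bar>pd j (pd i f) w - pd i (pd j f) w\<bar> \<le> 0"
    by (rule field_le_epsilon) simp
  then show ?thesis by simp
qed

text \<open>A frame \<open>P\<close> of coordinate vector fields of a parametrisation \<open>s\<close>, with its connection
  coefficients \<open>Z\<close>.\<close>

lemma coordinate_frame_symmetric_flat:
  fixes s :: "real^'n::finite \<Rightarrow> real^'n" and P :: "'n \<Rightarrow> real^'n \<Rightarrow> real^'n"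
  assumes S: "open S" "w \<in> S"
    and s: "C1_on S s" "\<And>j x. x \<in> S \<Longrightarrow> pd j s x = P j x"
    and P: "\<And>j. C1_on S (P j)" "\<And>i j x. x \<in> S \<Longrightarrow> pd i (P j) x = (\<Sum>k\<in>UNIV. Z k i j x *\<^sub>R P k x)"
    and Z: "\<And>k i j. C1_on S (Z k i j)"
    and indep: "\<And>c x. x \<in> S \<Longrightarrow> (\<Sum>k\<in>UNIV. c k *\<^sub>R P k x) = 0 \<Longrightarrow> \<forall>k. c k = 0"
  shows "Z k i j w = Z k j i w"
    and "pd l (Z k i j) w + (\<Sum>p\<in>UNIV. Z p i j w * Z k l p w) = pd i (Z k l j) w + (\<Sum>p\<in>UNIV. Z p l j w * Z k i p w)"
proof -
  \<comment> \<open>Independence lets frame coefficients be compared one vector component at a time,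
    because \<open>pd_pd_commute\<close> concerns real functions.\<close>
  have eqI: "c k = d k" if "\<And>m. (\<Sum>k\<in>UNIV. c k * P k w $ m) = (\<Sum>k\<in>UNIV. d k * P k w $ m)" for c d k
  proof -
    have "(\<Sum>k\<in>UNIV. (c k - d k) *\<^sub>R P k w) = 0"
      using that by (simp add: vec_eq_iff left_diff_distrib sum_subtractf)
    from indep[OF S(2) this] show ?thesis by simp
  qed
  have Pm: "C1_on S (\<lambda>x. P j x $ m)" for j m
    by (rule C1_on_vec_nth[OF P(1)])
  have pdPm: "pd i (\<lambda>x. P j x $ m) x = (\<Sum>k\<in>UNIV. Z k i j x * P k x $ m)" if "x \<in> S" for i j m x
    using that by (simp add: pd_vec_nth[OF P(1)] P(2))
  have ZP: "C1_on S (\<lambda>x. Z k i j x * P k x $ m)" for i j k m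
    by (rule C1_on_mult[OF Z Pm])
  \<comment> \<open>The connection equation itself raises regularity: it writes the partials of
    \<open>P j\<close> as sums of C1 products.\<close>
  have C1pdPm: "C1_on S (pd i (\<lambda>x. P j x $ m))" for i j m
    by (rule C1_on_cong[OF S(1) pdPm[symmetric]]) (auto intro: C1_on_sum ZP)
  show "Z k i j w = Z k j i w"
  proof (rule eqI[of "\<lambda>k. Z k i j w"])
    fix m
    have pds: "pd i (\<lambda>x. s x $ m) x = P i x $ m" if "x \<in> S" for i x
      using that by (simp add: pd_vec_nth[OF s(1)] s(2))
    have C1s: "C1_on S (pd i (\<lambda>x. s x $ m))" for i
      by (rule C1_on_cong[OF S(1) pds[symmetric] Pm])
    \<comment> \<open>As \<open>P i\<close> is \<open>pd i s\<close>, this says that the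
      \<open>j\<close>-partial of \<open>P i\<close> equals the \<open>i\<close>-partial of
      \<open>P j\<close>; comparing frame coefficients gives the symmetry.\<close>
    have "pd j (pd i (\<lambda>x. s x $ m)) w = pd i (pd j (\<lambda>x. s x $ m)) w"
      by (rule pd_pd_commute[OF S C1_on_vec_nth[OF s(1)] C1s C1s])
    then have "pd j (\<lambda>x. P i x $ m) w = pd i (\<lambda>x. P j x $ m) w"
      using pd_cong[OF S pds C1s] by simp
    then show "(\<Sum>k\<in>UNIV. Z k i j w * P k w $ m) = (\<Sum>k\<in>UNIV. Z k j i w * P k w $ m)"
      using pdPm S by simp
  qed
  \<comment> \<open>Differentiate the connection equation once more, substitute it for the partials
    of \<open>P k\<close>, and swap the sums to collect the coefficient of each \<open>P q\<close>.
    Symmetry in \<open>l\<close> and \<open>i\<close> is then flatness.\<close>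
  have expand: "pd l (pd i (\<lambda>x. P j x $ m)) w =
      (\<Sum>q\<in>UNIV. (pd l (Z q i j) w + (\<Sum>p\<in>UNIV. Z p i j w * Z q l p w)) * P q w $ m)" for l i m
  proof -
    have "pd l (pd i (\<lambda>x. P j x $ m)) w = pd l (\<lambda>x. \<Sum>k\<in>UNIV. Z k i j x * P k x $ m) w"
      by (rule pd_cong[OF S pdPm[symmetric]]) (auto intro: C1_on_sum ZP)
    also have "\<dots> = (\<Sum>k\<in>UNIV. pd l (\<lambda>x. Z k i j x * P k x $ m) w)"
      by (rule pd_sum[OF ZP S(2)])
    also have "\<dots> = (\<Sum>k\<in>UNIV. Z k i j w * (\<Sum>q\<in>UNIV. Z q l k w * P q w $ m) + pd l (Z k i j) w * P k w $ m)"
      by (simp add: pd_mult[OF Z Pm S(2)] pdPm[OF S(2)])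
    also have "\<dots> = (\<Sum>k\<in>UNIV. \<Sum>q\<in>UNIV. Z k i j w * Z q l k w * P q w $ m) + (\<Sum>k\<in>UNIV. pd l (Z k i j) w * P k w $ m)"
      by (simp add: sum.distrib sum_distrib_left mult.assoc)
    also have "(\<Sum>k\<in>UNIV. \<Sum>q\<in>UNIV. Z k i j w * Z q l k w * P q w $ m) =
       (\<Sum>q\<in>UNIV. \<Sum>k\<in>UNIV. Z k i j w * Z q l k w * P q w $ m)"
      by (rule sum.swap)
    finally show ?thesis
      by (simp add: sum.distrib distrib_right sum_distrib_right)
  qed
  show "pd l (Z k i j) w + (\<Sum>p\<in>UNIV. Z p i j w * Z k l p w) = pd i (Z k l j) w + (\<Sum>p\<in>UNIV. Z p l j w * Z k i p w)"
  proof (rule eqI[of "\<lambda>k. pd l (Z k i j) w + (\<Sum>p\<in>UNIV. Z p i j w * Z k l p w)"])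
    fix m
    have "pd l (pd i (\<lambda>x. P j x $ m)) w = pd i (pd l (\<lambda>x. P j x $ m)) w"
      by (rule pd_pd_commute[OF S Pm C1pdPm C1pdPm])
    then show "(\<Sum>k\<in>UNIV. (pd l (Z k i j) w + (\<Sum>p\<in>UNIV. Z p i j w * Z k l p w)) * P k w $ m) =
        (\<Sum>k\<in>UNIV. (pd i (Z k l j) w + (\<Sum>p\<in>UNIV. Z p l j w * Z k i p w)) * P k w $ m)"
      by (simp only: expand)
  qed
qed

section \<open>Compatibility of the system deduced from flatness\<close>

lemma sum_UNIV_single:
  fixes g :: "'n::finite \<Rightarrow> real"
  assumes "\<And>p. p \<noteq> j \<Longrightarrow> g p = 0"
  shows "sum g UNIV = g j"
  using assms by (simp add: sum.remove[of UNIV j])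

lemma sum_UNIV_two:
  fixes g :: "'n::finite \<Rightarrow> real"
  assumes "i \<noteq> j" "\<And>p. p \<noteq> i \<Longrightarrow> p \<noteq> j \<Longrightarrow> g p = 0"
  shows "sum g UNIV = g i + g j"
proof -
  have "sum g UNIV = sum g {i, j}"
    by (rule sum.mono_neutral_right) (use assms in auto)
  then show ?thesis using assms(1) by simp
qed

text \<open>These are the coefficient identities that equate the two ways of computing a mixed
  derivative of an unknown from the system. They are flatness equations with upper index
  \<open>j\<close> and \<open>i\<close>, whose sums collapse because \<open>Z\<close> vanishes on
  distinct indices.\<close>

lemma rich_compatibility:
  fixes Z :: "'n::finite \<Rightarrow> 'n \<Rightarrow> 'n \<Rightarrow> real^'n \<Rightarrow> real"
  assumes S: "open S" "w \<in> S"
    and C1: "\<And>k i j. C1_on S (Z k i j)"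
    and sym: "\<And>k i j x. x \<in> S \<Longrightarrow> Z k i j x = Z k j i x"
    and flat: "\<And>k i j l. pd l (Z k i j) w + (\<Sum>p\<in>UNIV. Z p i j w * Z k l p w) =
        pd i (Z k l j) w + (\<Sum>p\<in>UNIV. Z p l j w * Z k i p w)"
    and zero: "\<And>k i j x. x \<in> S \<Longrightarrow> i \<noteq> j \<Longrightarrow> j \<noteq> k \<Longrightarrow> i \<noteq> k \<Longrightarrow> Z k i j x = 0"
    and ijk: "i \<noteq> j" "j \<noteq> k" "i \<noteq> k"
  shows "pd k (Z j j i) w = pd i (Z j j k) w"
    and "pd k (Z i j j) w = Z j j k w * Z i j j w - Z i i k w * Z i j j w - Z i k k w * Z k j j w"
proof -
  have pdsym: "pd l (Z k i j) w = pd l (Z k j i) w" for k i j l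
    by (rule pd_cong[OF S sym C1])
  \<comment> \<open>For \<open>p\<close> other than \<open>i\<close> and \<open>j\<close> the first
    factor vanishes, for \<open>p = i\<close> the second; only \<open>p = j\<close> survives. The
    same product survives in the other sum, so the two cancel.\<close>
  have "(\<Sum>p\<in>UNIV. Z p i j w * Z j k p w) = Z j i j w * Z j k j w"
  proof (rule sum_UNIV_single)
    fix p assume p: "p \<noteq> j"
    show "Z p i j w * Z j k p w = 0"
      by (cases "p = i") (use p ijk S zero in auto)
  qed
  moreover have "(\<Sum>p\<in>UNIV. Z p k j w * Z j i p w) = Z j k j w * Z j i j w"
  proof (rule sum_UNIV_single)
    fix p assume p: "p \<noteq> j"
    show "Z p k j w * Z j i p w = 0"
      by (cases "p = k") (use p ijk S zero in auto)
  qed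
  ultimately have "pd k (Z j i j) w = pd i (Z j k j) w"
    using flat[of k j i j] by simp
  then show "pd k (Z j j i) w = pd i (Z j j k) w"
    using pdsym by metis
  \<comment> \<open>\<open>Z i k j\<close> is zero on the whole open set \<open>S\<close>, hence so
    is its derivative.\<close>
  have "pd j (Z i k j) w = 0"
    using pd_cong[of S w "\<lambda>x. 0" "Z i k j" j] zero ijk S by (auto simp: pd_def bderiv_const C1_on_const)
  \<comment> \<open>Here the second factor vanishes unless \<open>p\<close> is \<open>i\<close> or
    \<open>k\<close>; the term for \<open>p = k\<close> becomes the product of two
    \<open>b\<close>-coefficients in the compatibility condition.\<close>
  moreover have "(\<Sum>p\<in>UNIV. Z p j j w * Z i k p w) = Z i j j w * Z i k i w + Z k j j w * Z i k k w"
  proof (rule sum_UNIV_two[OF ijk(3)])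
    fix p assume p: "p \<noteq> i" "p \<noteq> k"
    show "Z p j j w * Z i k p w = 0"
      using p ijk S zero by auto
  qed
  moreover have "(\<Sum>p\<in>UNIV. Z p k j w * Z i j p w) = Z j k j w * Z i j j w"
  proof (rule sum_UNIV_single)
    fix p assume p: "p \<noteq> j"
    show "Z p k j w * Z i j p w = 0"
      by (cases "p = k") (use p ijk S zero in auto)
  qed
  ultimately have "pd k (Z i j j) w + (Z i j j w * Z i k i w + Z k j j w * Z i k k w) = Z j k j w * Z i j j w"
    using flat[of k i j j] by simp
  moreover have "Z i k i w = Z i i k w" "Z j k j w = Z j j k w"
    using sym S by auto
  ultimately show "pd k (Z i j j) w = Z j j k w * Z i j j w - Z i i k w * Z i j j w - Z i k k w * Z k j j w"
    by (simp add: algebra_simps)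
qed

section \<open>The homotopy operator along rays\<close>

text \<open>\<open>\<alpha>\<close> bounds the values and \<open>\<beta>\<close> the derivative.
  They are kept apart because integration along rays gains a factor of the radius for values, but
  only partly for derivatives.\<close>

definition C1_bounded_on :: "'a::real_normed_vector set \<Rightarrow> ('a \<Rightarrow> 'b::real_normed_vector) \<Rightarrow> real \<Rightarrow> real \<Rightarrow> bool" where
  "C1_bounded_on S f \<alpha> \<beta> \<longleftrightarrow> C1_on S f \<and> (\<forall>x\<in>S. norm (f x) \<le> \<alpha> \<and> norm (bderiv f x) \<le> \<beta>)"

lemma C1_bounded_onD:
  assumes "C1_bounded_on S f \<alpha> \<beta>"
  shows "C1_on S f" and "\<And>x. x \<in> S \<Longrightarrow> norm (f x) \<le> \<alpha>" and "\<And>x. x \<in> S \<Longrightarrow> norm (bderiv f x) \<le> \<beta>"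
  using assms by (auto simp: C1_bounded_on_def)

lemma C1_bounded_on_mono:
  assumes "C1_bounded_on S f \<alpha> \<beta>" "\<alpha> \<le> \<alpha>'" "\<beta> \<le> \<beta>'"
  shows "C1_bounded_on S f \<alpha>' \<beta>'"
  using assms unfolding C1_bounded_on_def by (meson order_trans)

lemma C1_bounded_on_subset:
  assumes "C1_bounded_on S f \<alpha> \<beta>" "T \<subseteq> S"
  shows "C1_bounded_on T f \<alpha> \<beta>"
  using assms by (auto simp: C1_bounded_on_def intro: C1_on_subset)

lemma C1_bounded_on_cong:
  assumes "open S" "\<And>y. y \<in> S \<Longrightarrow> f y = g y" "C1_bounded_on S f \<alpha> \<beta>"
  shows "C1_bounded_on S g \<alpha> \<beta>"
  using assms(3) C1_on_cong[OF assms(1,2)] bderiv_cong[OF assms(1) _ assms(2)] assms(2)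
  unfolding C1_bounded_on_def by simp

lemma C1_bounded_on_mult:
  fixes f g :: "'a::real_normed_vector \<Rightarrow> real"
  assumes f: "C1_bounded_on S f \<alpha> \<beta>" and g: "C1_bounded_on S g \<alpha>' \<beta>'"
  shows "C1_bounded_on S (\<lambda>x. f x * g x) (\<alpha> * \<alpha>') (\<alpha> * \<beta>' + \<beta> * \<alpha>')"
  unfolding C1_bounded_on_def
proof (intro conjI ballI)
  show "C1_on S (\<lambda>x. f x * g x)"
    by (intro C1_on_mult C1_bounded_onD(1)[OF f] C1_bounded_onD(1)[OF g])
  fix x assume x: "x \<in> S"
  note F = C1_bounded_onD[OF f] and G = C1_bounded_onD[OF g]
  have fx: "\<bar>f x\<bar> \<le> \<alpha>" and gx: "\<bar>g x\<bar> \<le> \<alpha>'"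
    using F(2)[OF x] G(2)[OF x] by simp_all
  show "norm (f x * g x) \<le> \<alpha> * \<alpha>'"
    using fx gx by (simp add: abs_mult mult_mono')
  have "bderiv (\<lambda>x. f x * g x) x = f x *\<^sub>R bderiv g x + g x *\<^sub>R bderiv f x"
    by (rule blinfun_eqI)
      (simp add: bounded_bilinear.bderiv_prod[OF bounded_bilinear_mult F(1) G(1) x] blinfun.add_left blinfun.scaleR_left
      bounded_bilinear.prod_left.rep_eq[OF bounded_bilinear_mult] bounded_bilinear.prod_right.rep_eq[OF bounded_bilinear_mult])
  also have "norm \<dots> \<le> \<bar>f x\<bar> * norm (bderiv g x) + norm (bderiv f x) * \<bar>g x\<bar>"
    using norm_triangle_ineq[of "f x *\<^sub>R bderiv g x" "g x *\<^sub>R bderiv f x"] by (simp add: mult.commute)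
  also have "\<dots> \<le> \<alpha> * \<beta>' + \<beta> * \<alpha>'"
    using fx gx F(3)[OF x] G(3)[OF x] by (intro add_mono mult_mono') auto
  finally show "norm (bderiv (\<lambda>x. f x * g x) x) \<le> \<alpha> * \<beta>' + \<beta> * \<alpha>'" .
qed

lemma C1_bounded_on_add:
  assumes f: "C1_bounded_on S f \<alpha> \<beta>" and g: "C1_bounded_on S g \<alpha>' \<beta>'"
  shows "C1_bounded_on S (\<lambda>x. f x + g x) (\<alpha> + \<alpha>') (\<beta> + \<beta>')"
  unfolding C1_bounded_on_def
proof (intro conjI ballI)
  note F = C1_bounded_onD[OF f] and G = C1_bounded_onD[OF g]
  show "C1_on S (\<lambda>x. f x + g x)"
    by (rule C1_on_add[OF F(1) G(1)])
  fix x assume x: "x \<in> S"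
  show "norm (f x + g x) \<le> \<alpha> + \<alpha>'" "norm (bderiv (\<lambda>x. f x + g x) x) \<le> \<beta> + \<beta>'"
    using F(2,3)[OF x] G(2,3)[OF x] by (auto simp: bderiv_add[OF F(1) G(1) x] intro: norm_triangle_mono)
qed

lemma norm_sum_le_CARD:
  fixes f :: "'n::finite \<Rightarrow> 'b::real_normed_vector" and K :: real
  assumes "\<And>i. i \<in> A \<Longrightarrow> norm (f i) \<le> K" "0 \<le> K"
  shows "norm (sum f A) \<le> CARD('n) * K"
proof -
  have "norm (sum f A) \<le> card A * K"
    using sum_norm_bound[of A f K] assms(1) by simp
  also have "\<dots> \<le> CARD('n) * K"
    using assms(2) by (intro mult_right_mono) (auto intro: card_mono)
  finally show ?thesis .
qed

text \<open>The segment that ends in \<open>w\<close> and starts at the point of the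
  \<open>j\<close>-line through \<open>c\<close> with the same \<open>j\<close>-th coordinate; it
  stays in the hyperplane where that coordinate is constant.\<close>

definition ray :: "real^'n::finite \<Rightarrow> 'n \<Rightarrow> real \<Rightarrow> real^'n \<Rightarrow> real^'n" where
  "ray c j t w = (\<chi> i. if i = j then w $ i else c $ i + t * (w $ i - c $ i))"

text \<open>Linear part of \<open>ray\<close>, written with the identity and the projection to the
  \<open>j\<close> axis so that continuity in \<open>t\<close> is immediate.\<close>

definition ray_linear :: "'n::finite \<Rightarrow> real \<Rightarrow> (real^'n) \<Rightarrow>\<^sub>L (real^'n)" where
  "ray_linear j t = t *\<^sub>R id_blinfun + (1 - t) *\<^sub>R Blinfun (\<lambda>v. v $ j *\<^sub>R axis j 1)"

lemma ray_linear_apply: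
  fixes v :: "real^'n::finite"
  shows "ray_linear j t v = (\<chi> i. if i = j then v $ i else t * v $ i)"
proof -
  have "bounded_linear (\<lambda>v::real^'n. v $ j *\<^sub>R axis j (1::real) :: real^'n)"
    by (intro bounded_linear_scaleR_const bounded_linear_vec_nth)
  then have *: "ray_linear j t v = t *\<^sub>R v + (1 - t) *\<^sub>R (v $ j *\<^sub>R axis j 1)"
    by (simp add: ray_linear_def blinfun.add_left blinfun.scaleR_left bounded_linear_Blinfun_apply)
  show ?thesis
    unfolding * by (auto simp: vec_eq_iff axis_def algebra_simps)
qed

lemma ray_eq: "ray c j t w = c + ray_linear j t (w - c)"
  by (simp add: ray_def ray_linear_apply vec_eq_iff)

lemma norm_ray_linear:
  fixes j :: "'n::finite"
  assumes "0 \<le> t" "t \<le> 1"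
  shows "norm (ray_linear j t) \<le> 1"
proof (rule norm_blinfun_bound)
  fix v :: "real^'n"
  show "norm (ray_linear j t v) \<le> 1 * norm v"
    using assms by (auto simp: ray_linear_apply abs_mult intro!: norm_le_componentwise_cart mult_left_le_one_le)
qed simp

text \<open>The linear part has norm at most 1. This is why balls about \<open>c\<close> serve as
  domains for the integral equation.\<close>

lemma ray_in_ball:
  assumes "w \<in> ball c d" "0 \<le> t" "t \<le> 1"
  shows "ray c j t w \<in> ball c d"
proof -
  have "norm (ray_linear j t (w - c)) \<le> norm (ray_linear j t) * norm (w - c)"
    by (rule norm_blinfun)
  also have "\<dots> \<le> 1 * norm (w - c)"
    by (rule mult_right_mono[OF norm_ray_linear[OF assms(2,3)]]) simp
  finally show ?thesis
    using assms(1) by (simp add: ray_eq dist_norm norm_minus_commute)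
qed

lemma ray_0: "ray c j 0 w = (\<chi> k. if k = j then w $ j else c $ k)"
  by (simp add: ray_def vec_eq_iff)

lemma ray_1 [simp]: "ray c j 1 w = w"
  by (simp add: ray_def vec_eq_iff)

lemma has_derivative_ray: "((\<lambda>w. ray c j t w) has_derivative blinfun_apply (ray_linear j t)) (at w)"
proof -
  have "((\<lambda>w. c + ray_linear j t (w - c)) has_derivative (\<lambda>h. 0 + ray_linear j t (h - 0))) (at w)"
    by (intro has_derivative_add has_derivative_const has_derivative_diff has_derivative_ident
        bounded_linear.has_derivative[OF blinfun.bounded_linear_right])
  then show ?thesis
    unfolding ray_eq by simp
qed

lemma continuous_on_ray: "continuous_on A (\<lambda>z. ray c j (snd z) (fst z))"
  unfolding ray_eq ray_linear_def by (intro continuous_intros)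

lemma continuous_on_ray_linear: "continuous_on A (\<lambda>z. ray_linear j (snd z))"
  unfolding ray_linear_def by (intro continuous_intros)

lemma vec_component_le_radius:
  fixes w :: "real^'n::finite"
  assumes "w \<in> ball c d"
  shows "\<bar>w $ k - c $ k\<bar> \<le> d"
proof -
  have "\<bar>(w - c) $ k\<bar> \<le> norm (w - c)"
    by (rule component_le_norm_cart)
  then show ?thesis
    using assms by (simp add: dist_norm norm_minus_commute)
qed

lemma has_real_derivative_along_ray:
  fixes f :: "real^'n::finite \<Rightarrow> real"
  assumes "C1_on S f" "ray c j t w \<in> S"
  shows "((\<lambda>t. f (ray c j t w)) has_real_derivative
    (\<Sum>k\<in>UNIV - {j}. (w $ k - c $ k) * pd k f (ray c j t w))) (at t)"
proof -
  let ?v = "\<Sum>k\<in>UNIV - {j}. (w $ k - c $ k) *\<^sub>R axis k 1 :: real^'n"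
  have v: "?v $ i = (if i = j then 0 else w $ i - c $ i)" for i
  proof -
    have "?v $ i = (\<Sum>k\<in>UNIV - {j}. if k = i then w $ i - c $ i else 0)"
      unfolding sum_component by (rule sum.cong) (auto simp: axis_def)
    then show ?thesis by simp
  qed
  have "(\<lambda>t. ray c j t w) = (\<lambda>t. ray c j 0 w + t *\<^sub>R ?v)"
  proof
    fix t
    show "ray c j t w = ray c j 0 w + t *\<^sub>R ?v"
      by (simp add: vec_eq_iff v ray_def del: sum_component)
  qed
  then have "((\<lambda>t. ray c j t w) has_derivative (\<lambda>t. t *\<^sub>R ?v)) (at t)"
    by (auto intro!: derivative_eq_intros)
  from has_derivative_compose[OF this C1_on_bderiv(1)[OF assms]]
  have "((\<lambda>t. f (ray c j t w)) has_derivative (\<lambda>s. bderiv f (ray c j t w) (s *\<^sub>R ?v))) (at t)" .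
  moreover have "(\<lambda>s. bderiv f (ray c j t w) (s *\<^sub>R ?v)) = (*) (\<Sum>k\<in>UNIV - {j}. (w $ k - c $ k) * pd k f (ray c j t w))"
    by (rule ext) (simp add: pd_def blinfun.scaleR_right blinfun.sum_right mult.commute)
  ultimately show ?thesis
    by (simp only: has_field_derivative_def)
qed

text \<open>Poincare's homotopy operator for the 1-form with coefficients \<open>F i\<close>,
  \<open>i \<noteq> j\<close>, on each hyperplane of constant \<open>j\<close>-th coordinate, based
  at its point on the \<open>j\<close>-line through \<open>c\<close>.\<close>

definition ray_integral :: "real^'n::finite \<Rightarrow> 'n \<Rightarrow> ('n \<Rightarrow> real^'n \<Rightarrow> real) \<Rightarrow> real^'n \<Rightarrow> real" where
  "ray_integral c j F w =
    integral {0..1} (\<lambda>t. \<Sum>i\<in>UNIV - {j}. (w $ i - c $ i) * F i (ray c j t w))"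

text \<open>Derivative in \<open>w\<close> of the integrand of \<open>ray_integral\<close>: the
  first summand differentiates the weight, the second the dependence of the ray on its
  endpoint.\<close>

definition ray_kernel_deriv ::
  "real^'n::finite \<Rightarrow> 'n \<Rightarrow> ('n \<Rightarrow> real^'n \<Rightarrow> real) \<Rightarrow> real^'n \<Rightarrow> real \<Rightarrow> (real^'n) \<Rightarrow>\<^sub>L real" where
  "ray_kernel_deriv c j F w t = (\<Sum>i\<in>UNIV - {j}. F i (ray c j t w) *\<^sub>R Blinfun (\<lambda>v. v $ i)
     + (w $ i - c $ i) *\<^sub>R (bderiv (F i) (ray c j t w) o\<^sub>L ray_linear j t))"

section \<open>Differentiability, bounds and defect of the ray integral\<close>

lemma Blinfun_vec_nth_apply [simp]: "Blinfun (\<lambda>v::real^'n::finite. v $ i) v = v $ i"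
  by (simp add: bounded_linear_Blinfun_apply bounded_linear_vec_nth)

lemma norm_Blinfun_vec_nth: "norm (Blinfun (\<lambda>v::real^'n::finite. v $ i)) \<le> 1"
  by (rule norm_blinfun_bound) (auto simp: component_le_norm_cart)

lemma continuous_on_section:
  assumes "w \<in> S" "continuous_on (S \<times> T) (\<lambda>z. f (fst z) (snd z))"
  shows "continuous_on T (f w)"
proof -
  have "continuous_on T (\<lambda>t. (w, t))"
    by (intro continuous_intros)
  from continuous_on_compose2[OF assms(2) this] show ?thesis
    using assms(1) by auto
qed

context
  fixes c :: "real^'n::finite" and d :: real and j :: 'n and F :: "'n \<Rightarrow> real^'n \<Rightarrow> real"
  assumes F: "\<And>i. C1_on (ball c d) (F i)"
begin

lemma ray_continuous_on_compose:
  assumes "continuous_on (ball c d) f"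
  shows "continuous_on (ball c d \<times> {0..1}) (\<lambda>z. f (ray c j (snd z) (fst z)))"
  by (rule continuous_on_compose2[OF assms continuous_on_ray]) (auto intro!: ray_in_ball simp del: mem_ball)

lemma continuous_on_ray_kernel:
  "continuous_on (ball c d \<times> {0..1}) (\<lambda>z. \<Sum>i\<in>UNIV - {j}. (fst z $ i - c $ i) * F i (ray c j (snd z) (fst z)))"
  by (intro continuous_intros ray_continuous_on_compose C1_on_imp_continuous_on[OF F])

lemma continuous_on_ray_kernel_deriv:
  "continuous_on (ball c d \<times> {0..1}) (\<lambda>z. ray_kernel_deriv c j F (fst z) (snd z))"
  unfolding ray_kernel_deriv_def
  by (intro continuous_intros ray_continuous_on_compose continuous_on_ray_linear C1_on_imp_continuous_on[OF F] C1_on_bderiv(2)[OF F])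

lemma has_derivative_ray_kernel:
  assumes w: "w \<in> ball c d" and t: "t \<in> {0..1}"
  shows "((\<lambda>w. \<Sum>i\<in>UNIV - {j}. (w $ i - c $ i) * F i (ray c j t w)) has_derivative
    blinfun_apply (ray_kernel_deriv c j F w t)) (at w)"
  unfolding ray_kernel_deriv_def
proof (rule has_derivative_blinfun_sum)
  fix i
  have r: "ray c j t w \<in> ball c d"
    using ray_in_ball[OF w] t by simp
  have "((\<lambda>w. F i (ray c j t w)) has_derivative blinfun_apply (bderiv (F i) (ray c j t w) o\<^sub>L ray_linear j t)) (at w)"
    by (rule has_derivative_blinfun_compose[OF has_derivative_ray C1_on_bderiv(1)[OF F r]])
  moreover have "((\<lambda>w. w $ i - c $ i) has_derivative (\<lambda>v. v $ i - 0)) (at w)"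
    by (intro has_derivative_diff has_derivative_const bounded_linear_imp_has_derivative bounded_linear_vec_nth)
  ultimately show "((\<lambda>w. (w $ i - c $ i) * F i (ray c j t w)) has_derivative
      blinfun_apply (F i (ray c j t w) *\<^sub>R Blinfun (\<lambda>v. v $ i)
     + (w $ i - c $ i) *\<^sub>R (bderiv (F i) (ray c j t w) o\<^sub>L ray_linear j t))) (at w)"
    by (rule has_derivative_blinfunI[OF has_derivative_mult[rotated]])
      (simp add: blinfun.add_left blinfun.scaleR_left)
qed

text \<open>Leibniz's rule: the derivative kernel is jointly continuous in \<open>w\<close> and
  \<open>t\<close>, so differentiation passes under the integral and the result depends continuously
  on \<open>w\<close>.\<close>

lemma
  shows C1_on_ray_integral: "C1_on (ball c d) (ray_integral c j F)"
    and bderiv_ray_integral: "w \<in> ball c d \<Longrightarrow>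
      bderiv (ray_integral c j F) w = integral {0..1} (ray_kernel_deriv c j F w)"
proof -
  have der: "(ray_integral c j F has_derivative blinfun_apply (integral {0..1} (ray_kernel_deriv c j F w))) (at w)"
    if w: "w \<in> ball c d" for w
  proof -
    have "((\<lambda>w. integral (cbox 0 1) (\<lambda>t. \<Sum>i\<in>UNIV - {j}. (w $ i - c $ i) * F i (ray c j t w))) has_derivative
        blinfun_apply (integral (cbox 0 1) (ray_kernel_deriv c j F w))) (at w within ball c d)"
    proof (rule leibniz_rule[OF _ _ _ w convex_ball])
      show "((\<lambda>w. \<Sum>i\<in>UNIV - {j}. (w $ i - c $ i) * F i (ray c j t w)) has_derivative
        blinfun_apply (ray_kernel_deriv c j F w t)) (at w within ball c d)" if "w \<in> ball c d" "t \<in> cbox 0 1" for w t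
        using has_derivative_ray_kernel[OF that(1), of t] that(2) by (simp add: has_derivative_at_withinI)
      show "(\<lambda>t. \<Sum>i\<in>UNIV - {j}. (w $ i - c $ i) * F i (ray c j t w)) integrable_on cbox 0 1" if "w \<in> ball c d" for w
        using integrable_continuous_real[OF continuous_on_section[OF that continuous_on_ray_kernel]] by simp
      show "continuous_on (ball c d \<times> cbox 0 1) (\<lambda>(w, t). ray_kernel_deriv c j F w t)"
        using continuous_on_ray_kernel_deriv by (simp add: case_prod_unfold)
    qed
    then show ?thesis
      using w by (simp add: at_within_open[OF _ open_ball] ray_integral_def[abs_def])
  qed
  show "bderiv (ray_integral c j F) w = integral {0..1} (ray_kernel_deriv c j F w)" if "w \<in> ball c d"
    by (rule bderiv_eqI[OF der[OF that]])
  have "continuous_on (ball c d) (\<lambda>w. integral (cbox 0 1) (ray_kernel_deriv c j F w))"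
    using continuous_on_ray_kernel_deriv
    by (intro integral_continuous_on_param) (simp add: case_prod_unfold)
  then show "C1_on (ball c d) (ray_integral c j F)"
    by (intro C1_onI[OF der]) simp_all
qed

text \<open>Each weight is at most \<open>d\<close> in absolute value. Differentiating the weight
  loses that factor, whence the term \<open>\<alpha>\<close> without \<open>d\<close> in the
  derivative bound.\<close>

lemma C1_bounded_on_ray_integral:
  assumes bd: "\<And>i. C1_bounded_on (ball c d) (F i) \<alpha> \<beta>" and d: "0 < d"
  shows "C1_bounded_on (ball c d) (ray_integral c j F) (CARD('n) * (d * \<alpha>)) (CARD('n) * (\<alpha> + d * \<beta>))"
proof -
  have cd: "c \<in> ball c d" using d by simp
  have pos: "0 \<le> \<alpha>" "0 \<le> \<beta>"
    using C1_bounded_onD(2,3)[OF bd cd] norm_ge_zero order_trans by blast+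
  have "norm (ray_integral c j F w) \<le> CARD('n) * (d * \<alpha>) * (1 - 0)" if w: "w \<in> ball c d" for w
    unfolding ray_integral_def
  proof (rule integral_bound)
    show "continuous_on {0..1} (\<lambda>t. \<Sum>i\<in>UNIV - {j}. (w $ i - c $ i) * F i (ray c j t w))"
      by (rule continuous_on_section[OF w continuous_on_ray_kernel])
    fix t :: real assume t: "t \<in> {0..1}"
    then have r: "ray c j t w \<in> ball c d" using ray_in_ball[OF w] by simp
    show "norm (\<Sum>i\<in>UNIV - {j}. (w $ i - c $ i) * F i (ray c j t w)) \<le> CARD('n) * (d * \<alpha>)"
    proof (rule norm_sum_le_CARD)
      fix i show "norm ((w $ i - c $ i) * F i (ray c j t w)) \<le> d * \<alpha>"
        using vec_component_le_radius[OF w] C1_bounded_onD(2)[OF bd r] d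
        by (simp add: abs_mult mult_mono')
    qed (use d pos in simp)
  qed simp
  moreover have "norm (bderiv (ray_integral c j F) w) \<le> CARD('n) * (\<alpha> + d * \<beta>) * (1 - 0)" if w: "w \<in> ball c d" for w
    unfolding bderiv_ray_integral[OF w]
  proof (rule integral_bound)
    show "continuous_on {0..1} (ray_kernel_deriv c j F w)"
      by (rule continuous_on_section[OF w continuous_on_ray_kernel_deriv])
    fix t :: real assume t: "t \<in> {0..1}"
    then have r: "ray c j t w \<in> ball c d" using ray_in_ball[OF w] by simp
    show "norm (ray_kernel_deriv c j F w t) \<le> CARD('n) * (\<alpha> + d * \<beta>)"
      unfolding ray_kernel_deriv_def
    proof (rule norm_sum_le_CARD)
      fix i
      have "norm (F i (ray c j t w) *\<^sub>R Blinfun (\<lambda>v::real^'n. v $ i)) \<le> \<alpha> * 1"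
        using C1_bounded_onD(2)[OF bd r] norm_Blinfun_vec_nth[of i] unfolding norm_scaleR
        by (intro mult_mono') auto
      moreover have "norm (bderiv (F i) (ray c j t w) o\<^sub>L ray_linear j t) \<le> \<beta> * 1"
        using C1_bounded_onD(3)[OF bd r, of i] norm_ray_linear[of t j] t
        by (intro order_trans[OF norm_blinfun_compose] mult_mono') auto
      then have "norm ((w $ i - c $ i) *\<^sub>R (bderiv (F i) (ray c j t w) o\<^sub>L ray_linear j t)) \<le> d * \<beta>"
        using vec_component_le_radius[OF w] d unfolding norm_scaleR by (intro mult_mono') auto
      ultimately show "norm (F i (ray c j t w) *\<^sub>R Blinfun (\<lambda>v::real^'n. v $ i) +
          (w $ i - c $ i) *\<^sub>R (bderiv (F i) (ray c j t w) o\<^sub>L ray_linear j t)) \<le> \<alpha> + d * \<beta>"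
        using norm_triangle_mono by fastforce
    qed (use d pos in simp)
  qed simp
  ultimately show ?thesis
    unfolding C1_bounded_on_def using C1_on_ray_integral by simp
qed

text \<open>Poincare's lemma in quantitative form: the leafwise primitive differentiates back to \<open>F\<close> up to
  the curl of \<open>F\<close> along the leaf.\<close>

lemma ray_integral_defect:
  assumes w: "w \<in> ball c d" and ij: "i \<noteq> j" and \<kappa>: "0 \<le> \<kappa>" "0 < d"
    and curl: "\<And>x k. x \<in> ball c d \<Longrightarrow> k \<noteq> j \<Longrightarrow> \<bar>pd i (F k) x - pd k (F i) x\<bar> \<le> \<kappa>"
  shows "\<bar>pd i (ray_integral c j F) w - F i w\<bar> \<le> CARD('n) * (d * \<kappa>)"
proof -
  let ?r = "\<lambda>t. ray c j t w"
  have r: "?r t \<in> ball c d" if "t \<in> {0..1}" for t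
    using ray_in_ball[OF w] that by simp
  have "ray_linear j t (axis i 1) = t *\<^sub>R axis i 1" for t
    using ij by (auto simp: ray_linear_apply vec_eq_iff axis_def)
  \<comment> \<open>As \<open>i \<noteq> j\<close>, moving \<open>w\<close> along axis
    \<open>i\<close> moves the ray point along the same axis at rate \<open>t\<close>; hence the
    factor \<open>t\<close>.\<close>
  then have K: "ray_kernel_deriv c j F w t (axis i 1) =
      F i (?r t) + (\<Sum>k\<in>UNIV - {j}. (w $ k - c $ k) * (t * pd i (F k) (?r t)))" for t
    using ij by (simp add: ray_kernel_deriv_def blinfun.sum_left blinfun.add_left blinfun.scaleR_left blinfun.scaleR_right
        sum.distrib pd_def axis_def if_distrib cong: if_cong)
  have Ki: "(ray_kernel_deriv c j F w) integrable_on {0..1}"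
    by (rule integrable_continuous_real[OF continuous_on_section[OF w continuous_on_ray_kernel_deriv]])
  have "bounded_linear (\<lambda>A. blinfun_apply A (axis i 1 :: real^'n) :: real)"
    by (rule blinfun.bounded_linear_left)
  from has_integral_linear[OF integrable_integral[OF Ki] this]
  have 1: "((\<lambda>t. F i (?r t) + (\<Sum>k\<in>UNIV - {j}. (w $ k - c $ k) * (t * pd i (F k) (?r t)))) has_integral
      pd i (ray_integral c j F) w) {0..1}"
    by (simp add: pd_def bderiv_ray_integral[OF w] comp_def K)
  \<comment> \<open>\<open>t * F i (?r t)\<close> goes from 0 to \<open>F i w\<close>. Subtracting
    the integral of its derivative from the one for \<open>pd i\<close> leaves only the curl,
    weighted by \<open>t\<close>.\<close>
  have "((\<lambda>t. t * F i (?r t)) has_vector_derivative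
      (F i (?r t) + t * (\<Sum>k\<in>UNIV - {j}. (w $ k - c $ k) * pd k (F i) (?r t)))) (at t within {0..1})"
    if "t \<in> {0..1}" for t
  proof -
    have "((\<lambda>t. t * F i (?r t)) has_real_derivative
      (1 * F i (?r t) + (\<Sum>k\<in>UNIV - {j}. (w $ k - c $ k) * pd k (F i) (?r t)) * t)) (at t)"
      by (rule DERIV_mult[OF DERIV_ident has_real_derivative_along_ray[OF F r[OF that]]])
    then show ?thesis
      by (simp add: has_real_derivative_iff_has_vector_derivative[symmetric] has_field_derivative_at_within mult.commute)
  qed
  then have 2: "((\<lambda>t. F i (?r t) + t * (\<Sum>k\<in>UNIV - {j}. (w $ k - c $ k) * pd k (F i) (?r t))) has_integral
      1 * F i (?r 1) - 0 * F i (?r 0)) {0..1}"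
    by (intro fundamental_theorem_of_calculus) auto
  have 3: "((\<lambda>t. t * (\<Sum>k\<in>UNIV - {j}. (w $ k - c $ k) * (pd i (F k) (?r t) - pd k (F i) (?r t)))) has_integral
      pd i (ray_integral c j F) w - F i w) {0..1}"
    using has_integral_diff[OF 1 2]
    by (simp add: sum_distrib_left algebra_simps sum_subtractf sum.distrib)
  have "norm (pd i (ray_integral c j F) w - F i w) \<le> CARD('n) * (d * \<kappa>) * measure lborel (cbox 0 (1::real))"
  proof (rule has_integral_bound)
    show "((\<lambda>t. t * (\<Sum>k\<in>UNIV - {j}. (w $ k - c $ k) * (pd i (F k) (?r t) - pd k (F i) (?r t)))) has_integral
      pd i (ray_integral c j F) w - F i w) (cbox 0 1)"
      using 3 by simp
    fix t :: real assume t: "t \<in> cbox 0 1"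
    have "norm (\<Sum>k\<in>UNIV - {j}. (w $ k - c $ k) * (pd i (F k) (?r t) - pd k (F i) (?r t))) \<le> CARD('n) * (d * \<kappa>)"
    proof (rule norm_sum_le_CARD)
      fix k assume "k \<in> UNIV - {j}"
      then show "norm ((w $ k - c $ k) * (pd i (F k) (?r t) - pd k (F i) (?r t))) \<le> d * \<kappa>"
        using vec_component_le_radius[OF w] curl[OF r, of t k] t \<kappa> by (simp add: abs_mult mult_mono')
    qed (use \<kappa> in simp)
    then show "norm (t * (\<Sum>k\<in>UNIV - {j}. (w $ k - c $ k) * (pd i (F k) (?r t) - pd k (F i) (?r t)))) \<le> CARD('n) * (d * \<kappa>)"
      using t by (simp add: abs_mult) (meson abs_ge_zero mult_left_le_one_le order_trans)
  qed (use \<kappa> in simp)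
  then show ?thesis by simp
qed

end

lemma ray_integral_diff:
  assumes F: "\<And>i. C1_on (ball c d) (F i)" and G: "\<And>i. C1_on (ball c d) (G i)" and w: "w \<in> ball c d"
  shows "ray_integral c j (\<lambda>i x. F i x - G i x) w = ray_integral c j F w - ray_integral c j G w"
proof -
  have i: "(\<lambda>t. \<Sum>i\<in>UNIV - {j}. (w $ i - c $ i) * F i (ray c j t w)) integrable_on {0..1}"
    if "\<And>i. C1_on (ball c d) (F i)" for F
    by (rule integrable_continuous_real[OF continuous_on_section[OF w continuous_on_ray_kernel[OF that]]])
  show ?thesis
    unfolding ray_integral_def integral_diff[OF i[OF F] i[OF G], symmetric]
    by (simp add: right_diff_distrib sum_subtractf)
qed

text \<open>All weights vanish on the \<open>j\<close>-line, so adding a ray integral does not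
  disturb the prescribed data.\<close>

lemma ray_integral_axis:
  assumes "\<And>i. i \<noteq> j \<Longrightarrow> w $ i = c $ i"
  shows "ray_integral c j F w = 0"
  using assms by (simp add: ray_integral_def)

section \<open>Compatible systems on a ball\<close>

text \<open>The M-test makes the series of derivatives converge uniformly. On a convex set,
  convergence of the values at one point then permits termwise differentiation, and the uniform
  limit keeps the derivative continuous.\<close>

lemma C1_on_series:
  fixes h :: "nat \<Rightarrow> 'a::real_normed_vector \<Rightarrow> real"
  assumes S: "open S" "convex S"
    and h: "\<And>n. C1_bounded_on S (h n) (A * (1/2) ^ n) (A' * (1/2) ^ n)"
  shows "\<exists>s. C1_on S s \<and> (\<forall>x\<in>S. (\<lambda>n. h n x) sums s x \<and> (\<lambda>n. bderiv (h n) x) sums bderiv s x)"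
proof (cases "S = {}")
  case True
  then show ?thesis by (auto simp: C1_on_def)
next
  case False
  then obtain x0 where x0: "x0 \<in> S" by blast
  have geo: "summable (\<lambda>n. K * (1/2) ^ n)" for K :: real
    by (intro summable_mult summable_geometric) simp
  let ?D = "\<lambda>x. \<Sum>n. bderiv (h n) x"
  have ul: "uniform_limit S (\<lambda>n x. \<Sum>i<n. bderiv (h i) x) ?D sequentially"
    by (rule Weierstrass_m_test[OF C1_bounded_onD(3)[OF h] geo])
  have bs: "summable (\<lambda>n. bderiv (h n) x)" if "x \<in> S" for x
    by (rule summable_comparison_test'[OF geo C1_bounded_onD(3)[OF h that]])
  have "(\<lambda>n. h n x0) sums (\<Sum>n. h n x0)"
    by (rule summable_sums, rule summable_comparison_test'[OF geo C1_bounded_onD(2)[OF h x0]])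
  then have "\<exists>s. \<forall>x\<in>S. (\<lambda>n. h n x) sums s x \<and> (s has_derivative blinfun_apply (?D x)) (at x within S)"
  proof (rule has_derivative_series[OF S(2) _ _ x0, of h "\<lambda>n x. blinfun_apply (bderiv (h n) x)" "\<lambda>x. blinfun_apply (?D x)", rotated 2])
    show "(h n has_derivative blinfun_apply (bderiv (h n) x)) (at x within S)" if "x \<in> S" for n x
      by (rule has_derivative_at_withinI[OF C1_on_bderiv(1)[OF C1_bounded_onD(1)[OF h] that]])
    fix e :: real assume e: "e > 0"
    from uniform_limitD[OF ul this]
    show "\<forall>\<^sub>F n in sequentially. \<forall>x\<in>S. \<forall>v. norm ((\<Sum>i<n. bderiv (h i) x v) - ?D x v) \<le> e * norm v"
    proof (rule eventually_mono, intro ballI allI)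
      fix n x v assume "\<forall>x\<in>S. dist (\<Sum>i<n. bderiv (h i) x) (?D x) < e" and "x \<in> S"
      then have "norm ((\<Sum>i<n. bderiv (h i) x) - ?D x) \<le> e"
        by (auto simp: dist_norm intro: less_imp_le)
      then have "norm (((\<Sum>i<n. bderiv (h i) x) - ?D x) v) \<le> e * norm v"
        by (intro order_trans[OF norm_blinfun] mult_right_mono) auto
      then show "norm ((\<Sum>i<n. bderiv (h i) x v) - ?D x v) \<le> e * norm v"
        by (simp add: blinfun.diff_left blinfun.sum_left)
    qed
  qed
  then obtain s where s: "\<And>x. x \<in> S \<Longrightarrow> (\<lambda>n. h n x) sums s x"
    "\<And>x. x \<in> S \<Longrightarrow> (s has_derivative blinfun_apply (?D x)) (at x)"
    using at_within_open[OF _ S(1)] by metis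
  have "continuous_on S ?D"
    by (rule uniform_limit_theorem[OF _ ul])
      (auto intro!: always_eventually continuous_on_sum C1_on_bderiv(2)[OF C1_bounded_onD(1)[OF h]])
  then have "C1_on S s"
    by (intro C1_onI[OF s(2)])
  moreover have "(\<lambda>n. bderiv (h n) x) sums bderiv s x" if "x \<in> S" for x
    using bs[OF that] bderiv_eqI[OF s(2)[OF that]] by (simp add: summable_sums)
  ultimately show ?thesis using s(1) by blast
qed

text \<open>Right-hand side of the equation for the \<open>i\<close>-th partial of the
  \<open>j\<close>-th unknown; only the unknowns \<open>j\<close> and \<open>i\<close>
  enter.\<close>

definition darboux_rhs :: "('n \<Rightarrow> 'n \<Rightarrow> 'a \<Rightarrow> real) \<Rightarrow> ('n \<Rightarrow> 'n \<Rightarrow> 'a \<Rightarrow> real) \<Rightarrow> ('n \<Rightarrow> 'a \<Rightarrow> real) \<Rightarrow> 'n \<Rightarrow> 'n \<Rightarrow> 'a \<Rightarrow> real" where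
  "darboux_rhs a b g j i x = a j i x * g j x + b j i x * g i x"

text \<open>Picard iterates for \<open>\<gamma> j = \<Phi> j + ray_integral c j (darboux_rhs a b
  \<gamma> j)\<close>.\<close>

primrec darboux_iter :: "real^'n::finite \<Rightarrow> ('n \<Rightarrow> 'n \<Rightarrow> real^'n \<Rightarrow> real) \<Rightarrow> ('n \<Rightarrow> 'n \<Rightarrow> real^'n \<Rightarrow> real)
    \<Rightarrow> ('n \<Rightarrow> real^'n \<Rightarrow> real) \<Rightarrow> nat \<Rightarrow> 'n \<Rightarrow> real^'n \<Rightarrow> real" where
  "darboux_iter c a b \<Phi> 0 = \<Phi>"
| "darboux_iter c a b \<Phi> (Suc m) =
    (\<lambda>j x. \<Phi> j x + ray_integral c j (darboux_rhs a b (darboux_iter c a b \<Phi> m) j) x)"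

text \<open>The curl bound has constant 4 and must shrink to a quarter after integration, which
  takes the 16 in \<open>small\<close>. The Picard increments then halve as well, in values and in
  derivatives, where \<open>d \<le> 1\<close> absorbs a mixed term.\<close>

locale darboux_ball =
  fixes c :: "real^'n::finite" and d M :: real
    and a b :: "'n \<Rightarrow> 'n \<Rightarrow> real^'n \<Rightarrow> real"
  assumes d: "0 < d" "d \<le> 1" and M: "0 \<le> M" and small: "16 * (M * CARD('n) * d) \<le> 1"
    and a: "\<And>j i. C1_bounded_on (ball c d) (a j i) M M"
    and b: "\<And>j i. C1_bounded_on (ball c d) (b j i) M M"
begin

abbreviation "rhs \<equiv> darboux_rhs a b"

lemma small_mult:
  assumes "0 \<le> S"
  shows "16 * (CARD('n) * (d * (M * S))) \<le> S"
  using mult_right_mono[OF small assms] by (simp add: mult_ac)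

lemma rhs_abs_le:
  assumes "\<And>j. \<bar>g j x\<bar> \<le> S" "x \<in> ball c d"
  shows "\<bar>rhs g j i x\<bar> \<le> 2 * M * S"
proof -
  have "\<bar>a j i x * g j x\<bar> \<le> M * S" "\<bar>b j i x * g i x\<bar> \<le> M * S"
    using assms(1) C1_bounded_onD(2)[OF a assms(2), of j i] C1_bounded_onD(2)[OF b assms(2), of j i] M
    by (auto simp: abs_mult intro!: mult_mono')
  then show ?thesis
    by (simp add: darboux_rhs_def)
qed

lemma C1_on_rhs:
  assumes "\<And>j. C1_on (ball c d) (g j)"
  shows "C1_on (ball c d) (rhs g j i)"
  unfolding darboux_rhs_def[abs_def]
  by (intro C1_on_add C1_on_mult C1_bounded_onD(1)[OF a] C1_bounded_onD(1)[OF b] assms)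

lemma C1_bounded_on_rhs:
  assumes "\<And>j. C1_bounded_on (ball c d) (g j) \<alpha> \<beta>"
  shows "C1_bounded_on (ball c d) (rhs g j i) (2 * M * \<alpha>) (2 * M * (\<alpha> + \<beta>))"
proof -
  have "C1_bounded_on (ball c d) (rhs g j i) (M * \<alpha> + M * \<alpha>) ((M * \<beta> + M * \<alpha>) + (M * \<beta> + M * \<alpha>))"
    unfolding darboux_rhs_def[abs_def]
    by (intro C1_bounded_on_add C1_bounded_on_mult a b assms)
  then show ?thesis
    by (rule C1_bounded_on_mono) (simp_all add: algebra_simps)
qed

lemma rhs_diff: "rhs (\<lambda>j x. f j x - g j x) j i x = rhs f j i x - rhs g j i x"
  by (simp add: darboux_rhs_def algebra_simps)

text \<open>Meant for the difference of two solutions. Each component vanishes on its axis, and the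
  mean value theorem along the ray bounds it by a small multiple of any common bound for all
  components; so such a bound can be halved indefinitely.\<close>

lemma unique:
  assumes g: "\<And>j. C1_on (ball c d) (g j)" "\<And>j x. x \<in> ball c d \<Longrightarrow> \<bar>g j x\<bar> \<le> S"
    and pde: "\<And>j i x. x \<in> ball c d \<Longrightarrow> i \<noteq> j \<Longrightarrow> pd i (g j) x = rhs g j i x"
    and axis: "\<And>j x. x \<in> ball c d \<Longrightarrow> (\<And>i. i \<noteq> j \<Longrightarrow> x $ i = c $ i) \<Longrightarrow> g j x = 0"
    and w: "w \<in> ball c d"
  shows "g j w = 0"
proof -
  have S0: "0 \<le> S"
    using g(2)[OF w, of j] by simp
  have "\<bar>g j w\<bar> \<le> S * (1/2) ^ m" if "w \<in> ball c d" for m j w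
    using that
  proof (induction m arbitrary: j w)
    case 0
    then show ?case using g(2) by simp
  next
    case (Suc m)
    let ?S = "S * (1/2) ^ m"
    have S: "0 \<le> ?S" using S0 by simp
    have r: "ray c j t w \<in> ball c d" if "0 \<le> t" "t \<le> 1" for t
      using ray_in_ball[OF Suc.prems that] .
    have "\<exists>z. 0 < z \<and> z < 1 \<and> g j (ray c j 1 w) - g j (ray c j 0 w) =
       (1 - 0) * (\<Sum>k\<in>UNIV - {j}. (w $ k - c $ k) * pd k (g j) (ray c j z w))"
      by (rule MVT2) (auto intro!: has_real_derivative_along_ray[OF g(1)] r simp del: mem_ball)
    then obtain z where z: "0 < z" "z < 1"
      and eq: "g j (ray c j 1 w) - g j (ray c j 0 w) = (\<Sum>k\<in>UNIV - {j}. (w $ k - c $ k) * pd k (g j) (ray c j z w))"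
      by auto
    have rz: "ray c j z w \<in> ball c d" using r z by simp
    have "g j (ray c j 0 w) = 0"
      by (rule axis[OF r]) (simp_all add: ray_0)
    then have "g j w = (\<Sum>k\<in>UNIV - {j}. (w $ k - c $ k) * pd k (g j) (ray c j z w))"
      using eq by simp
    also have "norm \<dots> \<le> CARD('n) * (d * (2 * M * ?S))"
    proof (rule norm_sum_le_CARD)
      fix k assume "k \<in> UNIV - {j}"
      then have "\<bar>pd k (g j) (ray c j z w)\<bar> \<le> 2 * M * ?S"
        using pde[OF rz] rhs_abs_le[where g = g, OF Suc.IH[OF rz] rz] by simp
      then show "norm ((w $ k - c $ k) * pd k (g j) (ray c j z w)) \<le> d * (2 * M * ?S)"
        using vec_component_le_radius[OF Suc.prems] by (simp add: abs_mult mult_mono')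
    qed (use d M S in simp)
    also have "\<dots> \<le> S * (1/2) ^ Suc m"
      using small_mult[OF S] S by simp
    finally show ?case by simp
  qed
  then have le: "\<bar>g j w\<bar> \<le> S * (1/2) ^ m" for m
    using w by blast
  have "(\<lambda>m. S * (1/2) ^ m) \<longlonglongrightarrow> 0"
    by (intro tendsto_mult_right_zero LIMSEQ_power_zero) simp
  then have "\<bar>g j w\<bar> \<le> 0"
    by (rule LIMSEQ_le_const) (use le in blast)
  then show ?thesis by simp
qed

end

text \<open>Equating the two mixed derivatives of unknown \<open>j\<close> computed from the system:
  the coefficient of unknown \<open>j\<close> gives \<open>compat_a\<close>, that of
  \<open>i\<close> gives \<open>compat_b\<close>, and that of \<open>k\<close> is
  \<open>compat_b\<close> with \<open>i\<close> and \<open>k\<close> exchanged.\<close>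

locale darboux_compatible = darboux_ball c d M a b
  for c :: "real^'n::finite" and d M :: real and a b :: "'n \<Rightarrow> 'n \<Rightarrow> real^'n \<Rightarrow> real" +
  assumes compat_a: "\<And>i j k x. x \<in> ball c d \<Longrightarrow> i \<noteq> j \<Longrightarrow> j \<noteq> k \<Longrightarrow> i \<noteq> k \<Longrightarrow> pd k (a j i) x = pd i (a j k) x"
    and compat_b: "\<And>i j k x. x \<in> ball c d \<Longrightarrow> i \<noteq> j \<Longrightarrow> j \<noteq> k \<Longrightarrow> i \<noteq> k \<Longrightarrow>
      pd k (b j i) x = a j k x * b j i x + b j k x * b k i x - b j i x * a i k x"
begin

text \<open>By compatibility the curl of the right-hand side only involves the defects in the equations.\<close>

lemma rhs_curl:
  assumes g: "\<And>j. C1_on (ball c d) (g j)" and x: "x \<in> ball c d" and ij: "i \<noteq> j" "k \<noteq> j" and Q: "0 \<le> Q"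
    and defect: "\<And>i j. i \<noteq> j \<Longrightarrow> \<bar>pd i (g j) x - rhs g j i x\<bar> \<le> Q"
  shows "\<bar>pd i (rhs g j k) x - pd k (rhs g j i) x\<bar> \<le> 4 * M * Q"
proof (cases "i = k")
  case True
  then show ?thesis using M Q by simp
next
  case ik: False
  have C: "C1_on (ball c d) (a j i)" "C1_on (ball c d) (b j i)" for j i
    using C1_bounded_onD(1)[OF a] C1_bounded_onD(1)[OF b] by auto
  have expand: "pd l (rhs g j m) x = a j m x * pd l (g j) x + pd l (a j m) x * g j x
     + (b j m x * pd l (g m) x + pd l (b j m) x * g m x)" for j l m
  proof -
    have "pd l (rhs g j m) x = pd l (\<lambda>x. a j m x * g j x) x + pd l (\<lambda>x. b j m x * g m x) x"
      unfolding darboux_rhs_def[abs_def] pd_def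
      by (subst bderiv_add[OF C1_on_mult[OF C(1) g] C1_on_mult[OF C(2) g] x]) (simp add: blinfun.add_left)
    then show ?thesis
      by (simp add: pd_mult[OF C(1) g x] pd_mult[OF C(2) g x])
  qed
  let ?G = "\<lambda>j i. pd i (g j) x - rhs g j i x"
  \<comment> \<open>With each partial written as right-hand side plus defect \<open>?G\<close>, the
    defect-free part cancels by compatibility; four products remain, each at most
    \<open>M * Q\<close>.\<close>
  have "pd i (rhs g j k) x - pd k (rhs g j i) x =
      (a j k x * ?G j i + b j k x * ?G k i) - (a j i x * ?G j k + b j i x * ?G i k)"
  proof -
    have ca: "pd k (a j i) x = pd i (a j k) x"
      using compat_a[OF x, of i j k] ij ik by auto
    have cb: "pd k (b j i) x = a j k x * b j i x + b j k x * b k i x - b j i x * a i k x"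
      "pd i (b j k) x = a j i x * b j k x + b j i x * b i k x - b j k x * a k i x"
      using compat_b[OF x, of i j k] compat_b[OF x, of k j i] ij ik by auto
    show ?thesis
      unfolding expand ca cb by (simp add: darboux_rhs_def algebra_simps)
  qed
  moreover have "\<bar>u * ?G p q\<bar> \<le> M * Q" if "\<bar>u\<bar> \<le> M" "q \<noteq> p" for u p q
    using defect[OF that(2)] that(1) by (simp add: abs_mult mult_mono')
  then have "\<bar>a j k x * ?G j i\<bar> \<le> M * Q" "\<bar>b j k x * ?G k i\<bar> \<le> M * Q"
    "\<bar>a j i x * ?G j k\<bar> \<le> M * Q" "\<bar>b j i x * ?G i k\<bar> \<le> M * Q"
    using C1_bounded_onD(2)[OF a x] C1_bounded_onD(2)[OF b x] ij ik by auto
  ultimately show ?thesis by linarith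
qed

text \<open>The homotopy operator recovers the prescribed differential only up to curl, so
  convergence to a fixed point is not enough. Two sequences are shown to decay geometrically: the
  increments in C1, which yields a limit, and the defects of the iterates, which makes the limit a
  solution.\<close>

lemma exists_solution:
  assumes \<Phi>: "\<And>j. C1_bounded_on (ball c d) (\<Phi> j) L L"
    and \<Phi>0: "\<And>i j x. x \<in> ball c d \<Longrightarrow> i \<noteq> j \<Longrightarrow> pd i (\<Phi> j) x = 0"
  shows "\<exists>\<gamma>. (\<forall>j. C1_on (ball c d) (\<gamma> j)) \<and>
    (\<forall>x\<in>ball c d. \<forall>i j. i \<noteq> j \<longrightarrow> pd i (\<gamma> j) x = rhs \<gamma> j i x) \<and>
    (\<forall>j. \<forall>x\<in>ball c d. (\<forall>i. i \<noteq> j \<longrightarrow> x $ i = c $ i) \<longrightarrow> \<gamma> j x = \<Phi> j x)"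
proof -
  let ?B = "ball c d"
  define g where "g = darboux_iter c a b \<Phi>"
  have g0: "g 0 = \<Phi>" and gSuc: "g (Suc m) j x = \<Phi> j x + ray_integral c j (rhs (g m) j) x" for m j x
    by (simp_all add: g_def)
  define h where "h m j x = g (Suc m) j x - g m j x" for m j x
  have cB: "c \<in> ?B" using d by simp
  have L: "0 \<le> L"
    using C1_bounded_onD(2)[OF \<Phi> cB] norm_ge_zero order_trans by blast
  note C1\<Phi> = C1_bounded_onD(1)[OF \<Phi>]
  have gSuc': "g (Suc m) j = (\<lambda>x. \<Phi> j x + ray_integral c j (rhs (g m) j) x)" for m j
    by (rule ext) (rule gSuc)
  have C1g: "C1_on ?B (g m j)" for m j
  proof (induction m arbitrary: j)
    case 0
    then show ?case by (simp add: g0 C1\<Phi>)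
  next
    case (Suc m)
    show ?case
      unfolding gSuc' by (intro C1_on_add C1\<Phi> C1_on_ray_integral C1_on_rhs Suc.IH)
  qed
  \<comment> \<open>\<open>A\<close> and the first entry of \<open>A'\<close> bound the first
    increment and its derivative. The second entry of \<open>A'\<close> lets the value bound be
    absorbed into the derivative bound in each later step.\<close>
  define A where "A = CARD('n) * (d * (2 * M * L))"
  define A' where "A' = max (CARD('n) * (2 * M * L + d * (2 * M * (L + L)))) (16 * (M * CARD('n) * A))"
  have A: "0 \<le> A" unfolding A_def using d M L by simp
  have A': "16 * (M * CARD('n) * A) \<le> A'" by (simp add: A'_def)
  have A'0: "0 \<le> A'" using A' M A by (intro order_trans[OF _ A']) simp
  have h: "C1_bounded_on ?B (h m j) (A * (1/2) ^ m) (A' * (1/2) ^ m)" for m j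
  proof (induction m arbitrary: j)
    case 0
    have "C1_bounded_on ?B (ray_integral c j (rhs \<Phi> j)) (CARD('n) * (d * (2 * M * L))) (CARD('n) * (2 * M * L + d * (2 * M * (L + L))))"
      by (rule C1_bounded_on_ray_integral[OF C1_on_rhs[OF C1\<Phi>] C1_bounded_on_rhs[OF \<Phi>] d(1)])
    then have "C1_bounded_on ?B (ray_integral c j (rhs \<Phi> j)) A A'"
      by (rule C1_bounded_on_mono) (simp_all add: A_def A'_def)
    moreover have "h 0 j = ray_integral c j (rhs \<Phi> j)"
      by (rule ext) (simp add: h_def gSuc g0)
    ultimately show ?case by simp
  next
    case (Suc m)
    let ?p = "(1/2::real) ^ m"
    have p: "0 \<le> ?p" by simp
    have "C1_bounded_on ?B (ray_integral c j (rhs (h m) j)) (CARD('n) * (d * (2 * M * (A * ?p))))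
        (CARD('n) * (2 * M * (A * ?p) + d * (2 * M * (A * ?p + A' * ?p))))"
      by (rule C1_bounded_on_ray_integral[OF C1_on_rhs[OF C1_bounded_onD(1)[OF Suc.IH]] C1_bounded_on_rhs[OF Suc.IH] d(1)])
    moreover have "CARD('n) * (d * (2 * M * (A * ?p))) \<le> A * (1/2) ^ Suc m"
    proof -
      have "0 \<le> CARD('n) * (d * (M * (A * ?p)))" using d M A by simp
      then show ?thesis using small_mult[of "A * ?p"] A by simp
    qed
    moreover have "CARD('n) * (2 * M * (A * ?p) + d * (2 * M * (A * ?p + A' * ?p))) \<le> A' * (1/2) ^ Suc m"
    proof -
      \<comment> \<open>\<open>X\<close> is the share of the value bound, \<open>W\<close> that of
        the derivative bound; \<open>2 * X\<close>, \<open>2 * (d * X)\<close> and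
        \<open>2 * W\<close> are each at most an eighth of \<open>A' * ?p\<close>.\<close>
      define X W where "X = M * CARD('n) * A * ?p" and "W = CARD('n) * (d * (M * (A' * ?p)))"
      have "16 * X \<le> A' * ?p"
        using mult_right_mono[OF A' p] by (simp add: X_def mult_ac)
      moreover have "d * X \<le> 1 * X"
        by (rule mult_right_mono[OF d(2)]) (use M A in \<open>simp add: X_def\<close>)
      moreover have "16 * W \<le> A' * ?p"
        unfolding W_def by (rule small_mult) (use A'0 in simp)
      moreover have "0 \<le> A' * ?p"
        using A'0 by simp
      ultimately have "2 * X + 2 * (d * X) + 2 * W \<le> A' * ?p / 2"
        by linarith
      moreover have "CARD('n) * (2 * M * (A * ?p) + d * (2 * M * (A * ?p + A' * ?p))) = 2 * X + 2 * (d * X) + 2 * W"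
        by (simp add: X_def W_def algebra_simps)
      ultimately show ?thesis by simp
    qed
    ultimately have "C1_bounded_on ?B (ray_integral c j (rhs (h m) j)) (A * (1/2) ^ Suc m) (A' * (1/2) ^ Suc m)"
      by (rule C1_bounded_on_mono)
    \<comment> \<open>The right-hand side and the ray integral are linear, so the next increment is
      the same operator applied to the present one.\<close>
    moreover have "ray_integral c j (rhs (h m) j) x = h (Suc m) j x" if "x \<in> ?B" for x
    proof -
      have "rhs (h m) j = (\<lambda>i x. rhs (g (Suc m)) j i x - rhs (g m) j i x)"
        by (simp add: fun_eq_iff h_def[abs_def] rhs_diff)
      then have "ray_integral c j (rhs (h m) j) x = ray_integral c j (rhs (g (Suc m)) j) x - ray_integral c j (rhs (g m) j) x"
        by (simp only: ray_integral_diff[OF C1_on_rhs[OF C1g] C1_on_rhs[OF C1g] that])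
      then show ?thesis
        unfolding h_def gSuc[of "Suc m"] gSuc[of m] by simp
    qed
    ultimately show ?case
      using C1_bounded_on_cong[OF open_ball] by blast
  qed
  \<comment> \<open>The second entry starts the induction, where the defect is just the right-hand
    side at \<open>\<Phi>\<close>; the first makes the contribution of each increment at most a
    quarter of the present bound.\<close>
  define Q where "Q = max (8 * (M * A)) (2 * M * L)"
  have Q: "0 \<le> Q" "8 * (M * A) \<le> Q" "2 * M * L \<le> Q"
    using M A L by (auto simp: Q_def le_max_iff_disj)
  have defect: "\<bar>pd i (g m j) x - rhs (g m) j i x\<bar> \<le> Q * (1/2) ^ m" if "x \<in> ?B" "i \<noteq> j" for m i j x
    using that
  proof (induction m arbitrary: i j x)
    case 0
    have "\<bar>rhs \<Phi> j i x\<bar> \<le> 2 * M * L"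
      using C1_bounded_onD(2)[OF \<Phi> 0(1)] by (intro rhs_abs_le[OF _ 0(1)]) simp
    then show ?case
      using \<Phi>0[OF 0] Q(3) by (simp add: g0)
  next
    case (Suc m)
    let ?p = "(1/2::real) ^ m"
    have "pd i (g (Suc m) j) x = pd i (\<Phi> j) x + pd i (ray_integral c j (rhs (g m) j)) x"
      unfolding gSuc' pd_def
      by (subst bderiv_add[OF C1\<Phi> C1_on_ray_integral[OF C1_on_rhs[OF C1g]] Suc.prems(1)]) (simp add: blinfun.add_left)
    \<comment> \<open>The new defect splits into the homotopy defect of \<open>rhs (g m)\<close>,
      controlled through its curl by the previous defects, and the change \<open>rhs (h m)\<close>.
      Each takes a quarter of the old bound, together a half.\<close>
    then have "pd i (g (Suc m) j) x - rhs (g (Suc m)) j i x =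
        (pd i (ray_integral c j (rhs (g m) j)) x - rhs (g m) j i x) - rhs (h m) j i x"
      using \<Phi>0[OF Suc.prems] rhs_diff[of "g (Suc m)" "g m" j i x] by (simp add: h_def[abs_def])
    moreover have "\<bar>pd i (ray_integral c j (rhs (g m) j)) x - rhs (g m) j i x\<bar> \<le> CARD('n) * (d * (4 * M * (Q * ?p)))"
    proof (rule ray_integral_defect[OF C1_on_rhs[OF C1g] Suc.prems])
      show "\<bar>pd i (rhs (g m) j k) y - pd k (rhs (g m) j i) y\<bar> \<le> 4 * M * (Q * ?p)" if "y \<in> ?B" "k \<noteq> j" for y k
        by (rule rhs_curl[OF C1g that(1) Suc.prems(2) that(2)]) (use Q Suc.IH[OF that(1)] in auto)
    qed (use M Q d in auto)
    moreover have "CARD('n) * (d * (4 * M * (Q * ?p))) \<le> Q * ?p / 4"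
      using small_mult[of "Q * ?p"] Q by simp
    moreover have "\<bar>rhs (h m) j i x\<bar> \<le> 2 * M * (A * ?p)"
      using C1_bounded_onD(2)[OF h Suc.prems(1)] by (intro rhs_abs_le[OF _ Suc.prems(1)]) simp
    moreover have "2 * M * (A * ?p) \<le> Q * ?p / 4"
      using mult_right_mono[OF Q(2), of ?p] by simp
    ultimately have "\<bar>pd i (g (Suc m) j) x - rhs (g (Suc m)) j i x\<bar> \<le> Q * ?p / 4 + Q * ?p / 4"
      by linarith
    then show ?case by simp
  qed
  have "\<forall>j. \<exists>s. C1_on ?B s \<and> (\<forall>x\<in>?B. (\<lambda>n. h n j x) sums s x \<and> (\<lambda>n. bderiv (h n j) x) sums bderiv s x)"
    using C1_on_series[OF open_ball convex_ball, of c d "\<lambda>n. h n j" A A' for j] h by blast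
  then obtain s where s: "\<And>j. C1_on ?B (s j)"
    "\<And>j x. x \<in> ?B \<Longrightarrow> (\<lambda>n. h n j x) sums s j x"
    "\<And>j x. x \<in> ?B \<Longrightarrow> (\<lambda>n. bderiv (h n j) x) sums bderiv (s j) x"
    by metis
  \<comment> \<open>The partial sums of \<open>h\<close> telescope, so this is the limit of the
    iterates, and likewise for the derivatives.\<close>
  define \<gamma> where "\<gamma> j x = \<Phi> j x + s j x" for j x
  have C1\<gamma>: "C1_on ?B (\<gamma> j)" for j
    unfolding \<gamma>_def[abs_def] by (intro C1_on_add C1\<Phi> s)
  have gsum: "(\<lambda>m. g m j x) \<longlonglongrightarrow> \<gamma> j x" if "x \<in> ?B" for j x
  proof -
    have "\<Phi> j x + (\<Sum>n<m. h n j x) = g m j x" for m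
      using sum_lessThan_telescope[of "\<lambda>n. g n j x" m] by (simp add: h_def g0)
    then show ?thesis
      using tendsto_add[OF tendsto_const[of "\<Phi> j x"] s(2)[OF that, unfolded sums_def, of j]] by (simp add: \<gamma>_def)
  qed
  have dsum: "(\<lambda>m. pd i (g m j) x) \<longlonglongrightarrow> pd i (\<gamma> j) x" if "x \<in> ?B" for i j x
  proof -
    have "bderiv (\<Phi> j) x + (\<Sum>n<m. bderiv (h n j) x) = bderiv (g m j) x" for m
    proof -
      have "bderiv (h n j) x = bderiv (g (Suc n) j) x - bderiv (g n j) x" for n
        unfolding h_def[abs_def] by (rule bderiv_diff[OF C1g C1g that])
      then show ?thesis
        using sum_lessThan_telescope[of "\<lambda>n. bderiv (g n j) x" m] by (simp add: g0)
    qed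
    then have "(\<lambda>m. bderiv (g m j) x) \<longlonglongrightarrow> bderiv (\<gamma> j) x"
      using tendsto_add[OF tendsto_const[of "bderiv (\<Phi> j) x"] s(3)[OF that, unfolded sums_def, of j]]
      unfolding \<gamma>_def[abs_def] by (simp add: bderiv_add[OF C1\<Phi> s(1) that])
    then show ?thesis
      unfolding pd_def by (intro tendsto_intros)
  qed
  have "pd i (\<gamma> j) x = rhs \<gamma> j i x" if x: "x \<in> ?B" "i \<noteq> j" for i j x
  proof -
    \<comment> \<open>Values and partials converge pointwise, so the defect of the limit is the
      limit of the defects.\<close>
    have "(\<lambda>m. \<bar>pd i (g m j) x - rhs (g m) j i x\<bar>) \<longlonglongrightarrow> \<bar>pd i (\<gamma> j) x - rhs \<gamma> j i x\<bar>"
      unfolding darboux_rhs_def by (intro tendsto_intros dsum gsum x)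
    moreover have "(\<lambda>m. Q * (1/2) ^ m) \<longlonglongrightarrow> 0"
      by (intro tendsto_mult_right_zero LIMSEQ_power_zero) simp
    ultimately have "\<bar>pd i (\<gamma> j) x - rhs \<gamma> j i x\<bar> \<le> 0"
      by (rule LIMSEQ_le) (use defect[OF x] in auto)
    then show ?thesis by simp
  qed
  note pde = this
  have axis: "\<gamma> j x = \<Phi> j x" if x: "x \<in> ?B" "\<forall>i. i \<noteq> j \<longrightarrow> x $ i = c $ i" for j x
  proof -
    have "g m j x = \<Phi> j x" for m
      using x(2) by (cases m) (simp_all add: g0 gSuc ray_integral_axis)
    then show ?thesis
      using LIMSEQ_unique[OF gsum[OF x(1), of j]] by simp
  qed
  show ?thesis
    by (intro exI[of _ \<gamma>] conjI allI ballI impI C1\<gamma> pde axis) simp_all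
qed

end

section \<open>Riemann coordinates\<close>

text \<open>Continuity at \<open>c\<close> bounds each function and its derivative by the norms
  there plus one. As the family is finite, the sum of the bounds and the least radius serve all
  members.\<close>

lemma C1_bounded_on_near:
  fixes f :: "'k::finite \<Rightarrow> 'a::real_normed_vector \<Rightarrow> 'b::real_normed_vector"
  assumes S: "open S" "c \<in> S" and f: "\<And>k. C1_on S (f k)"
  shows "\<exists>M\<ge>0. \<exists>e>0. ball c e \<subseteq> S \<and> (\<forall>k. C1_bounded_on (ball c e) (f k) M M)"
proof -
  have "\<exists>M e. M \<ge> 0 \<and> e > 0 \<and> ball c e \<subseteq> S \<and> C1_bounded_on (ball c e) (f k) M M" for k
  proof -
    have "isCont (f k) c" "isCont (bderiv (f k)) c"
      using C1_on_imp_continuous_on[OF f] C1_on_bderiv(2)[OF f] S by (auto simp: continuous_on_eq_continuous_at)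
    then obtain d1 d2 where d: "d1 > 0" "d2 > 0"
      and d1: "\<And>x. dist x c < d1 \<Longrightarrow> dist (f k x) (f k c) < 1"
      and d2: "\<And>x. dist x c < d2 \<Longrightarrow> dist (bderiv (f k) x) (bderiv (f k) c) < 1"
      unfolding continuous_at_eps_delta using zero_less_one by blast
    obtain d3 where d3: "d3 > 0" "ball c d3 \<subseteq> S"
      using S openE by blast
    define e where "e = min d1 (min d2 d3)"
    define M where "M = max (norm (f k c) + 1) (norm (bderiv (f k) c) + 1)"
    have e: "e > 0" "ball c e \<subseteq> S" using d d3 by (auto simp: e_def)
    have "norm (f k x) \<le> M \<and> norm (bderiv (f k) x) \<le> M" if "x \<in> ball c e" for x
    proof -
      have "norm (f k x - f k c) < 1" "norm (bderiv (f k) x - bderiv (f k) c) < 1"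
        using d1[of x] d2[of x] that by (auto simp: e_def dist_commute dist_norm[symmetric])
      then show ?thesis
        using norm_triangle_ineq2[of "f k x" "f k c"] norm_triangle_ineq2[of "bderiv (f k) x" "bderiv (f k) c"]
        unfolding M_def by linarith
    qed
    then have "C1_bounded_on (ball c e) (f k) M M"
      using C1_on_subset[OF f e(2)] by (simp add: C1_bounded_on_def)
    moreover have "M \<ge> 0" by (simp add: M_def le_max_iff_disj)
    ultimately show ?thesis using e by blast
  qed
  then obtain M e where Me: "\<And>k. M k \<ge> (0::real)" "\<And>k. e k > (0::real)" "\<And>k. ball c (e k) \<subseteq> S"
    "\<And>k. C1_bounded_on (ball c (e k)) (f k) (M k) (M k)"
    by metis
  define M0 where "M0 = (\<Sum>k\<in>UNIV. M k)"
  define e0 where "e0 = Min (range e)"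
  have M0: "M k \<le> M0" for k
    unfolding M0_def by (rule member_le_sum) (use Me in auto)
  have e0: "e0 \<le> e k" for k
    unfolding e0_def by simp
  have "C1_bounded_on (ball c e0) (f k) M0 M0" for k
    by (rule C1_bounded_on_mono[OF C1_bounded_on_subset[OF Me(4)[of k] subset_ball[OF e0]] M0 M0])
  moreover have "M0 \<ge> 0" unfolding M0_def by (rule sum_nonneg) (use Me in simp)
  moreover have "e0 > 0" unfolding e0_def using Me(2) by simp
  moreover have "ball c e0 \<subseteq> S" using subset_ball[OF e0] Me(3) by blast
  ultimately show ?thesis by blast
qed

section \<open>The inverse coordinate map and its connection coefficients\<close>

lemma matrix_inv_invertible:
  fixes A :: "real^'n^'n"
  assumes "invertible A"
  shows "A ** matrix_inv A = mat 1" and "matrix_inv A ** A = mat 1"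
  using assms someI_ex[of "\<lambda>A'. A ** A' = mat 1 \<and> A' ** A = mat 1"]
  by (auto simp: invertible_def matrix_inv_def)

lemma frame_matrix_mult:
  "frame_matrix r u *v z = (\<Sum>k\<in>UNIV. z $ k *\<^sub>R r k u)"
  by (simp add: matrix_mult_sum frame_matrix_def column_def scalar_mult_eq_scaleR)

locale riemann_coordinates =
  fixes \<Omega> :: "(real^'n::finite) set" and r :: "'n \<Rightarrow> real^'n \<Rightarrow> real^'n"
    and \<rho> :: "real^'n \<Rightarrow> real^'n" and U :: "(real^'n) set"
  assumes \<Omega>: "open \<Omega>" and frame: "is_frame \<Omega> r" and r_C2: "\<And>i. C2_on \<Omega> (r i)"
    and U: "open U" "U \<subseteq> \<Omega>" and \<rho>: "inj_on \<rho> U" "open (\<rho> ` U)"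
    and \<rho>_deriv: "\<And>u. u \<in> U \<Longrightarrow> \<exists>D\<rho>. (\<rho> has_derivative D\<rho>) (at u) \<and>
                   (\<forall>i j. D\<rho> (r j u) $ i = (if i = j then 1 else 0))"
begin

abbreviation "\<sigma> \<equiv> the_inv_into U \<rho>"
abbreviation "P \<equiv> \<lambda>j w. r j (\<sigma> w)"
abbreviation "Z \<equiv> Zcoef r U \<rho>"

lemma \<sigma>_in: "w \<in> \<rho> ` U \<Longrightarrow> \<sigma> w \<in> U"
  by (rule the_inv_into_into[OF \<rho>(1)]) auto

lemma \<sigma>_in_\<Omega>: "w \<in> \<rho> ` U \<Longrightarrow> \<sigma> w \<in> \<Omega>"
  using \<sigma>_in U(2) by blast

text \<open>The derivative of \<open>\<rho>\<close> sends \<open>r j\<close> to the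
  \<open>j\<close>-th basis vector, so combining the frame with given coordinates is a right inverse
  of it; the inverse function theorem makes this the derivative of \<open>\<sigma>\<close>.\<close>

lemma has_derivative_\<sigma>:
  assumes w: "w \<in> \<rho> ` U"
  shows "(\<sigma> has_derivative (\<lambda>v. \<Sum>j\<in>UNIV. v $ j *\<^sub>R P j w)) (at w)"
proof -
  have cont: "continuous_on U \<rho>"
  proof (intro continuous_at_imp_continuous_on ballI)
    fix u assume "u \<in> U"
    then obtain D where "(\<rho> has_derivative D) (at u)" using \<rho>_deriv by blast
    then show "isCont \<rho> u" by (rule has_derivative_continuous)
  qed
  obtain D where D: "(\<rho> has_derivative D) (at (\<sigma> w))" "\<And>i j. D (P j w) $ i = (if i = j then 1 else 0)"
    using \<rho>_deriv[OF \<sigma>_in[OF w]] by blast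
  have lin: "linear D"
    using has_derivative_linear[OF D(1)] .
  have "D \<circ> (\<lambda>v. \<Sum>j\<in>UNIV. v $ j *\<^sub>R P j w) = id"
  proof (rule ext)
    fix v
    have "D (\<Sum>j\<in>UNIV. v $ j *\<^sub>R P j w) = (\<Sum>j\<in>UNIV. v $ j *\<^sub>R D (P j w))"
      by (simp add: linear_sum[OF lin] linear_cmul[OF lin])
    also have "\<dots> = v"
      by (simp add: vec_eq_iff D(2) if_distrib cong: if_cong)
    finally show "(D \<circ> (\<lambda>v. \<Sum>j\<in>UNIV. v $ j *\<^sub>R P j w)) v = id v"
      by simp
  qed
  from has_derivative_inverse_strong[OF U(1) \<sigma>_in[OF w] cont the_inv_into_f_f[OF \<rho>(1)] D(1) this]
  show ?thesis
    by (simp add: f_the_inv_into_f[OF \<rho>(1) w])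
qed

lemmas r_C1 = C2_on_bderiv(1)[OF r_C2 \<Omega>] and bderiv_r_C1 = C2_on_bderiv(2)[OF r_C2 \<Omega>]

text \<open>The derivative of \<open>\<sigma>\<close> is built from the frame at
  \<open>\<sigma> w\<close>; since \<open>\<sigma>\<close> is differentiable and hence continuous,
  so is this derivative.\<close>

lemma C1_on_\<sigma>: "C1_on (\<rho> ` U) \<sigma>"
proof (rule C1_onI)
  let ?L = "\<lambda>w. \<Sum>j\<in>UNIV. blinfun_scaleR_left (P j w) o\<^sub>L Blinfun (\<lambda>v. v $ j)"
  show "(\<sigma> has_derivative blinfun_apply (?L w)) (at w)" if "w \<in> \<rho> ` U" for w
    by (rule has_derivative_blinfunI[OF has_derivative_\<sigma>[OF that]]) (simp add: blinfun.sum_left)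
  have "continuous_on (\<rho> ` U) \<sigma>"
    by (intro continuous_at_imp_continuous_on ballI has_derivative_continuous[OF has_derivative_\<sigma>])
  then have "continuous_on (\<rho> ` U) (P j)" for j
    using \<sigma>_in_\<Omega> by (intro continuous_on_compose2[OF C1_on_imp_continuous_on[OF r_C1]]) auto
  then show "continuous_on (\<rho> ` U) ?L"
    by (intro continuous_intros bounded_linear.continuous_on[OF bounded_linear_blinfun_scaleR_left])
qed

lemma pd_\<sigma>: "pd j \<sigma> w = P j w" if "w \<in> \<rho> ` U"
proof -
  have "(\<Sum>k\<in>UNIV. (axis j 1 :: real^'n) $ k *\<^sub>R P k w) = (\<Sum>k\<in>UNIV. if k = j then P j w else 0)"
    by (rule sum.cong) (auto simp: axis_def)
  then show ?thesis
    by (simp add: pd_eqI[OF has_derivative_\<sigma>[OF that]])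
qed

lemma C1_on_P: "C1_on (\<rho> ` U) (P j)"
  using \<sigma>_in_\<Omega> by (intro C1_on_compose[OF C1_on_\<sigma> r_C1]) auto

lemma pd_P: "pd i (P j) w = bderiv (r j) (\<sigma> w) (P i w)" if w: "w \<in> \<rho> ` U"
  using bderiv_compose[OF C1_on_\<sigma> r_C1 \<sigma>_in_\<Omega>[OF w] w] pd_\<sigma>[OF w]
  by (simp add: pd_def)

lemma invertible_frame: "w \<in> \<rho> ` U \<Longrightarrow> invertible (frame_matrix r (\<sigma> w))"
  using frame \<sigma>_in_\<Omega> by (simp add: is_frame_def)

text \<open>\<open>Gamma\<close> multiplies by the inverse frame matrix, and this undoes it. The
  linear system obtained yields both the connection equation and, by Cramer's rule, the smoothness
  of \<open>Z\<close>.\<close>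

lemma frame_mult_Z:
  assumes w: "w \<in> \<rho> ` U"
  shows "frame_matrix r (\<sigma> w) *v (\<chi> k. Z k i j w) = bderiv (r j) (\<sigma> w) (P i w)"
proof -
  have "(\<chi> k. Z k i j w) = matrix_inv (frame_matrix r (\<sigma> w)) *v bderiv (r j) (\<sigma> w) (P i w)"
    using frechet_derivative_at[OF C1_on_bderiv(1)[OF r_C1 \<sigma>_in_\<Omega>[OF w]], of j]
    by (simp add: vec_eq_iff Zcoef_def Gamma_def matrix_vector_mul_component)
  then show ?thesis
    by (simp add: matrix_vector_mul_assoc matrix_inv_invertible(1)[OF invertible_frame[OF w]])
qed

lemma pd_P_eq_Z: "pd i (P j) w = (\<Sum>k\<in>UNIV. Z k i j w *\<^sub>R P k w)" if w: "w \<in> \<rho> ` U"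
  using frame_mult_Z[OF w, of i j] by (simp add: pd_P[OF w] frame_matrix_mult)

lemma P_independent:
  assumes w: "w \<in> \<rho> ` U" and "(\<Sum>k\<in>UNIV. c k *\<^sub>R P k w) = 0"
  shows "\<forall>k. c k = 0"
proof -
  let ?A = "frame_matrix r (\<sigma> w)"
  have "?A *v (\<chi> k. c k) = 0"
    using assms(2) by (simp add: frame_matrix_mult)
  then have "(matrix_inv ?A ** ?A) *v (\<chi> k. c k) = 0"
    by (simp flip: matrix_vector_mul_assoc)
  then show ?thesis
    by (simp add: matrix_inv_invertible(2)[OF invertible_frame[OF w]] vec_eq_iff)
qed

text \<open>Smoothness of the inverse frame matrix is obtained from Cramer's rule.\<close>

lemma C1_on_Z: "C1_on (\<rho> ` U) (Z k i j)"
proof -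
  let ?y = "\<lambda>w. bderiv (r j) (\<sigma> w) (P i w)"
  let ?B = "\<lambda>w. \<chi> m l. if l = k then ?y w $ m else frame_matrix r (\<sigma> w) $ m $ l"
  have Pm: "C1_on (\<rho> ` U) (\<lambda>w. frame_matrix r (\<sigma> w) $ m $ l)" for m l
    using C1_on_vec_nth[OF C1_on_P] by (simp add: frame_matrix_def)
  \<comment> \<open>\<open>Z\<close> contains a first derivative of the frame; it is C1 because the
    frame is C2.\<close>
  have "C1_on (\<rho> ` U) (\<lambda>w. bderiv (r j) (\<sigma> w))"
    using \<sigma>_in_\<Omega> by (intro C1_on_compose[OF C1_on_\<sigma> bderiv_r_C1]) auto
  then have y: "C1_on (\<rho> ` U) ?y"
    by (rule C1_on_blinfun_apply[OF _ C1_on_P])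
  have det_nz: "det (frame_matrix r (\<sigma> w)) \<noteq> 0" if "w \<in> \<rho> ` U" for w
    using invertible_frame[OF that] by (simp add: invertible_det_nz)
  show ?thesis
  proof (rule C1_on_cong[OF \<rho>(2)])
    show "C1_on (\<rho> ` U) (\<lambda>w. det (?B w) * inverse (det (frame_matrix r (\<sigma> w))))"
    proof (intro C1_on_mult C1_on_inverse C1_on_det)
      show "C1_on (\<rho> ` U) (\<lambda>w. ?B w $ m $ l)" for m l
        using C1_on_vec_nth[OF y] Pm by (cases "l = k") simp_all
    qed (use Pm det_nz in auto)
    show "det (?B w) * inverse (det (frame_matrix r (\<sigma> w))) = Z k i j w" if w: "w \<in> \<rho> ` U" for w
    proof -
      have "(\<chi> k. Z k i j w) = (\<chi> k. det (\<chi> m l. if l = k then ?y w $ m else frame_matrix r (\<sigma> w) $ m $ l)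
          / det (frame_matrix r (\<sigma> w)))"
        using frame_mult_Z[OF w, of i j] cramer[OF det_nz[OF w]] by blast
      then have "(\<chi> k. Z k i j w) $ k = (\<chi> k. det (\<chi> m l. if l = k then ?y w $ m else frame_matrix r (\<sigma> w) $ m $ l)
          / det (frame_matrix r (\<sigma> w))) $ k"
        by simp
      then show ?thesis
        by (simp add: divide_inverse)
    qed
  qed
qed

lemma Z_symmetric:
  assumes w: "w \<in> \<rho> ` U"
  shows "Z k i j w = Z k j i w"
proof (rule coordinate_frame_symmetric_flat(1)[OF \<rho>(2) w C1_on_\<sigma> _ C1_on_P _ C1_on_Z])
  show "pd j \<sigma> x = P j x" "pd i (P j) x = (\<Sum>k\<in>UNIV. Z k i j x *\<^sub>R P k x)" if "x \<in> \<rho> ` U" for i j x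
    by (rule pd_\<sigma>[OF that] pd_P_eq_Z[OF that])+
  show "\<forall>k. c k = 0" if "x \<in> \<rho> ` U" "(\<Sum>k\<in>UNIV. c k *\<^sub>R P k x) = 0" for c x
    by (rule P_independent[OF that])
qed

lemma Z_flat:
  assumes w: "w \<in> \<rho> ` U"
  shows "pd l (Z k i j) w + (\<Sum>p\<in>UNIV. Z p i j w * Z k l p w) =
    pd i (Z k l j) w + (\<Sum>p\<in>UNIV. Z p l j w * Z k i p w)"
proof (rule coordinate_frame_symmetric_flat(2)[OF \<rho>(2) w C1_on_\<sigma> _ C1_on_P _ C1_on_Z])
  show "pd j \<sigma> x = P j x" "pd i (P j) x = (\<Sum>k\<in>UNIV. Z k i j x *\<^sub>R P k x)" if "x \<in> \<rho> ` U" for i j x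
    by (rule pd_\<sigma>[OF that] pd_P_eq_Z[OF that])+
  show "\<forall>k. c k = 0" if "x \<in> \<rho> ` U" "(\<Sum>k\<in>UNIV. c k *\<^sub>R P k x) = 0" for c x
    by (rule P_independent[OF that])
qed

end

section \<open>Construction of the local solution and comparison with a competing one\<close>

theorem theorem3p1:
  fixes \<Omega> :: "(real^'n::finite) set" and r :: "'n \<Rightarrow> real^'n \<Rightarrow> real^'n"
    and \<rho> :: "real^'n \<Rightarrow> real^'n" and U :: "(real^'n) set" and wbar :: "real^'n"
    and \<phi> :: "'n \<Rightarrow> real \<Rightarrow> real" and I :: "'n \<Rightarrow> real set"
  assumes "open \<Omega>" and "is_frame \<Omega> r" and "\<forall>i. C2_on \<Omega> (r i)" and "rich_frame \<Omega> r"
    and "open U" and "U \<subseteq> \<Omega>" and "inj_on \<rho> U" and "open (\<rho> ` U)" and "wbar \<in> \<rho> ` U"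
    and "\<forall>u\<in>U. \<exists>D\<rho>. (\<rho> has_derivative D\<rho>) (at u) \<and>
                   (\<forall>i j. D\<rho> (r j u) $ i = (if i = j then 1 else 0))"
    and "\<forall>w\<in>\<rho> ` U. \<forall>i j k. i \<noteq> j \<and> j \<noteq> k \<and> i \<noteq> k \<longrightarrow> Zcoef r U \<rho> k i j w = 0"
    and "\<forall>i. open (I i) \<and> wbar $ i \<in> I i \<and> C1_on (I i) (\<phi> i)"
  shows "\<exists>V \<gamma>. V \<subseteq> \<rho> ` U \<and> beta_local_solution (Zcoef r U \<rho>) wbar I \<phi> V \<gamma> \<and>
           (\<forall>V' \<gamma>'. V' \<subseteq> \<rho> ` U \<and> beta_local_solution (Zcoef r U \<rho>) wbar I \<phi> V' \<gamma>' \<longrightarrow>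
              (\<exists>W. open W \<and> wbar \<in> W \<and> W \<subseteq> V \<inter> V' \<and> (\<forall>w\<in>W. \<forall>j. \<gamma>' j w = \<gamma> j w)))"
proof -
  interpret riemann_coordinates \<Omega> r \<rho> U
    using assms by unfold_locales auto
  let ?S = "\<rho> ` U"
  have zero: "Z k i j x = 0" if "x \<in> ?S" "i \<noteq> j" "j \<noteq> k" "i \<noteq> k" for k i j x
    using assms(11) that by blast
  have compat: "pd k (Z j j i) x = pd i (Z j j k) x"
    "pd k (Z i j j) x = Z j j k x * Z i j j x - Z i i k x * Z i j j x - Z i k k x * Z k j j x"
    if x: "x \<in> ?S" and "i \<noteq> j" "j \<noteq> k" "i \<noteq> k" for i j k x
    using rich_compatibility[of ?S x Z i j k, OF \<rho>(2) x C1_on_Z] Z_symmetric Z_flat[OF x] zero that by blast+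
  define a where "a j i = Z j j i" for j i
  \<comment> \<open>The sign is put into \<open>b\<close>, so that the system takes the form
    \<open>darboux_rhs\<close>.\<close>
  define b where "b j i w = - Z i j j w" for j i w
  \<comment> \<open>Extends the data constantly over the hyperplanes of constant \<open>j\<close>-th
    coordinate, so that the partials in the other directions vanish.\<close>
  define \<Phi> where "\<Phi> j w = \<phi> j (w $ j)" for j w
  have pde_iff: "Z j j i w * g j w - Z i j j w * g i w = darboux_rhs a b g j i w" for g i j w
    by (simp add: darboux_rhs_def a_def b_def)
  have I: "open (I i)" "wbar $ i \<in> I i" "C1_on (I i) (\<phi> i)" for i
    using assms(12) by auto
  \<comment> \<open>Points all of whose coordinates lie in the domains of the data, so that every
    \<open>\<Phi> j\<close> is C1 there.\<close>
  define S' where "S' = ?S \<inter> (\<Inter>i. (\<lambda>w. w $ i) -` I i)"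
  have S': "open S'" "wbar \<in> S'" "S' \<subseteq> ?S"
    using assms(9) I \<rho>(2) unfolding S'_def by (auto intro!: open_Int open_INT open_vimage_vec_nth)
  have S'_I: "w $ i \<in> I i" if "w \<in> S'" for w i
    using that by (auto simp: S'_def)
  have C1_nth: "C1_on T (\<lambda>w::real^'n. w $ j)" for T j
    using C1_on_vec_nth[OF C1_on_blinfun[of T id_blinfun], of j] by simp
  have C1\<Phi>: "C1_on S' (\<Phi> j)" for j
    unfolding \<Phi>_def[abs_def] using S'_I by (intro C1_on_compose[OF C1_nth I(3)]) auto
  have pd\<Phi>: "pd i (\<Phi> j) w = 0" if "w \<in> S'" "i \<noteq> j" for i j w
  proof -
    have "bderiv (\<lambda>w::real^'n. w $ j) w (axis i 1) = 0"
      using pd_eqI[OF bounded_linear_imp_has_derivative[OF bounded_linear_vec_nth], of i j w] that(2)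
      by (simp add: pd_def axis_def)
    then show ?thesis
      unfolding \<Phi>_def[abs_def] pd_def
      by (simp add: bderiv_compose[OF C1_nth I(3) S'_I[OF that(1)] that(1)] blinfun.zero_right)
  qed
  have C1a: "C1_on S' (a j i)" and C1b: "C1_on S' (b j i)" for j i
    unfolding a_def[abs_def] b_def[abs_def] by (intro C1_on_uminus C1_on_subset[OF C1_on_Z S'(3)])+
  \<comment> \<open>Pairs of indices form a finite type, so one bound and one radius serve all
    \<open>a j i\<close>.\<close>
  have "\<exists>M\<ge>0. \<exists>e>0. ball wbar e \<subseteq> S' \<and> (\<forall>k::'n \<times> 'n. C1_bounded_on (ball wbar e) (a (fst k) (snd k)) M M)"
    by (rule C1_bounded_on_near[OF S'(1,2) C1a])
  then obtain Ma ea where Ma: "Ma \<ge> 0" "ea > 0" "ball wbar ea \<subseteq> S'"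
    and a_bd': "\<And>k::'n \<times> 'n. C1_bounded_on (ball wbar ea) (a (fst k) (snd k)) Ma Ma"
    by auto
  have a_bd: "C1_bounded_on (ball wbar ea) (a j i) Ma Ma" for j i
    using a_bd'[of "(j, i)"] by simp
  have "\<exists>M\<ge>0. \<exists>e>0. ball wbar e \<subseteq> S' \<and> (\<forall>k::'n \<times> 'n. C1_bounded_on (ball wbar e) (b (fst k) (snd k)) M M)"
    by (rule C1_bounded_on_near[OF S'(1,2) C1b])
  then obtain Mb eb where Mb: "Mb \<ge> 0" "eb > 0" "ball wbar eb \<subseteq> S'"
    and b_bd': "\<And>k::'n \<times> 'n. C1_bounded_on (ball wbar eb) (b (fst k) (snd k)) Mb Mb"
    by auto
  have b_bd: "C1_bounded_on (ball wbar eb) (b j i) Mb Mb" for j i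
    using b_bd'[of "(j, i)"] by simp
  obtain L el where L: "el > 0" and \<Phi>_bd: "\<And>j. C1_bounded_on (ball wbar el) (\<Phi> j) L L"
    using C1_bounded_on_near[OF S'(1,2), of \<Phi>] C1\<Phi> by auto
  define M where "M = max Ma Mb"
  \<comment> \<open>The last entry forces the smallness condition; the added 1 keeps the denominator
    positive when \<open>M = 0\<close>.\<close>
  define d where "d = min (min ea eb) (min el (min 1 (1 / (16 * M * CARD('n) + 1))))"
  have M: "0 \<le> M" using Ma by (simp add: M_def le_max_iff_disj)
  then have MN: "0 \<le> 16 * M * CARD('n)" by simp
  have "0 < 1 / (16 * M * CARD('n) + 1)"
    using MN by (intro divide_pos_pos) simp_all
  then have d: "0 < d" "d \<le> 1" "d \<le> ea" "d \<le> eb" "d \<le> el"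
    using Ma Mb L unfolding d_def by linarith+
  have "d \<le> 1 / (16 * M * CARD('n) + 1)" by (simp add: d_def)
  then have "d * (16 * M * CARD('n) + 1) \<le> 1"
    using MN by (simp add: pos_le_divide_eq)
  then have small: "16 * (M * CARD('n) * d) \<le> 1"
    using d by (simp add: algebra_simps)
  have ball_S': "ball wbar d \<subseteq> S'" using Ma(3) subset_ball[OF d(3)] by blast
  \<comment> \<open>Stated for smaller radii too, since uniqueness is proved on a ball shrunk into
    the domain of the competing solution.\<close>
  have ball: "darboux_ball wbar d' M a b" if "0 < d'" "d' \<le> d" for d'
  proof
    have "16 * (M * CARD('n) * d') \<le> 16 * (M * CARD('n) * d)"
      using that M by (intro mult_left_mono) auto
    then show "16 * (M * CARD('n) * d') \<le> 1" using small by simp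
    show "C1_bounded_on (ball wbar d') (a j i) M M" for j i
      by (rule C1_bounded_on_mono[OF C1_bounded_on_subset[OF a_bd subset_ball]]) (use that d in \<open>auto simp: M_def\<close>)
    show "C1_bounded_on (ball wbar d') (b j i) M M" for j i
      by (rule C1_bounded_on_mono[OF C1_bounded_on_subset[OF b_bd subset_ball]]) (use that d in \<open>auto simp: M_def\<close>)
  qed (use that d M in auto)
  interpret E: darboux_ball wbar d M a b
    using ball d by simp
  interpret E: darboux_compatible wbar d M a b
  proof
    fix i j k :: 'n and x assume x: "x \<in> ball wbar d" and ijk: "i \<noteq> j" "j \<noteq> k" "i \<noteq> k"
    have xS: "x \<in> ?S" using x ball_S' S'(3) by blast
    show "pd k (a j i) x = pd i (a j k) x"
      using compat(1)[OF xS ijk] by (simp add: a_def[abs_def])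
    have "pd k (b j i) x = - pd k (Z i j j) x"
      unfolding b_def[abs_def] pd_def by (simp add: bderiv_uminus[OF C1_on_Z xS] blinfun.minus_left)
    then show "pd k (b j i) x = a j k x * b j i x + b j k x * b k i x - b j i x * a i k x"
      using compat(2)[OF xS ijk] by (simp add: a_def b_def algebra_simps)
  qed
  have "\<exists>\<gamma>. (\<forall>j. C1_on (ball wbar d) (\<gamma> j)) \<and>
    (\<forall>x\<in>ball wbar d. \<forall>i j. i \<noteq> j \<longrightarrow> pd i (\<gamma> j) x = darboux_rhs a b \<gamma> j i x) \<and>
    (\<forall>j. \<forall>x\<in>ball wbar d. (\<forall>i. i \<noteq> j \<longrightarrow> x $ i = wbar $ i) \<longrightarrow> \<gamma> j x = \<Phi> j x)"
    by (rule E.exists_solution[OF C1_bounded_on_subset[OF \<Phi>_bd subset_ball[OF d(5)]] pd\<Phi>[OF subsetD[OF ball_S']]])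
  then obtain \<gamma> where \<gamma>_all: "(\<forall>j. C1_on (ball wbar d) (\<gamma> j)) \<and>
    (\<forall>x\<in>ball wbar d. \<forall>i j. i \<noteq> j \<longrightarrow> pd i (\<gamma> j) x = darboux_rhs a b \<gamma> j i x) \<and>
    (\<forall>j. \<forall>x\<in>ball wbar d. (\<forall>i. i \<noteq> j \<longrightarrow> x $ i = wbar $ i) \<longrightarrow> \<gamma> j x = \<Phi> j x)" ..
  then have \<gamma>: "C1_on (ball wbar d) (\<gamma> j)"
    "x \<in> ball wbar d \<Longrightarrow> i \<noteq> j \<Longrightarrow> pd i (\<gamma> j) x = darboux_rhs a b \<gamma> j i x"
    "x \<in> ball wbar d \<Longrightarrow> (\<And>i. i \<noteq> j \<Longrightarrow> x $ i = wbar $ i) \<Longrightarrow> \<gamma> j x = \<Phi> j x" for i j x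
    by (simp_all del: mem_ball)
  have sol: "beta_local_solution Z wbar I \<phi> (ball wbar d) \<gamma>"
    unfolding beta_local_solution_def
  proof (intro conjI allI ballI impI)
    fix w i j assume w: "w \<in> ball wbar d" and ij: "(i::'n) \<noteq> j"
    show "((\<lambda>t. \<gamma> j (w + t *\<^sub>R axis i 1)) has_real_derivative (Z j j i w * \<gamma> j w - Z i j j w * \<gamma> i w)) (at 0)"
      unfolding pde_iff using pd_has_real_derivative_line[OF \<gamma>(1), of w 0 i j] \<gamma>(2)[OF w ij] w by simp
  next
    fix i t assume "(\<chi> k. if k = i then t else wbar $ k) \<in> ball wbar d"
    from \<gamma>(3)[OF this, of i] show "\<gamma> i (\<chi> k. if k = i then t else wbar $ k) = \<phi> i t"
      by (simp add: \<Phi>_def)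
  qed (use d \<gamma> in auto)
  have uniq: "\<exists>W. open W \<and> wbar \<in> W \<and> W \<subseteq> ball wbar d \<inter> V' \<and> (\<forall>w\<in>W. \<forall>j. \<gamma>' j w = \<gamma> j w)"
    if sol': "beta_local_solution Z wbar I \<phi> V' \<gamma>'" for V' \<gamma>'
  proof -
    have V': "open V'" "wbar \<in> V'" and \<gamma>'C1: "\<And>j. C1_on V' (\<gamma>' j)"
      and \<gamma>'_der: "\<And>w i j. w \<in> V' \<Longrightarrow> i \<noteq> j \<Longrightarrow>
        ((\<lambda>t. \<gamma>' j (w + t *\<^sub>R axis i 1)) has_real_derivative darboux_rhs a b \<gamma>' j i w) (at 0)"
      and \<gamma>'_axis: "\<And>i t. t \<in> I i \<Longrightarrow> (\<chi> k. if k = i then t else wbar $ k) \<in> V' \<Longrightarrow>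
        \<gamma>' i (\<chi> k. if k = i then t else wbar $ k) = \<phi> i t"
      using sol' unfolding beta_local_solution_def pde_iff by auto
    let ?T = "ball wbar d \<inter> V'"
    define g where "g j x = \<gamma>' j x - \<gamma> j x" for j x
    have T: "open ?T" "wbar \<in> ?T" using V' d by auto
    have C1T: "C1_on ?T (\<gamma>' j)" "C1_on ?T (\<gamma> j)" for j
      using C1_on_subset[OF \<gamma>'C1] C1_on_subset[OF \<gamma>(1)] by auto
    have C1gT: "C1_on ?T (g j)" for j
      unfolding g_def[abs_def] by (intro C1_on_diff C1T)
    \<comment> \<open>The difference might be unbounded on all of \<open>?T\<close>; on a small ball
      it has a bound, from which the halving argument starts.\<close>
    obtain K e where e: "e > 0" "ball wbar e \<subseteq> ?T" and g_bd: "\<And>j. C1_bounded_on (ball wbar e) (g j) K K"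
      using C1_bounded_on_near[OF T, of g] C1gT by auto
    define d' where "d' = min d e"
    have d': "0 < d'" "d' \<le> d" "ball wbar d' \<subseteq> ?T" "d' \<le> e"
      using d e by (auto simp: d'_def)
    interpret D: darboux_ball wbar d' M a b by (rule ball[OF d'(1,2)])
    have "g j w = 0" if "w \<in> ball wbar d'" for j w
    proof (rule D.unique[OF _ _ _ _ that])
      show "C1_on (ball wbar d') (g j)" for j
        by (rule C1_on_subset[OF C1gT d'(3)])
      show "\<bar>g j x\<bar> \<le> K" if "x \<in> ball wbar d'" for j x
        using C1_bounded_onD(2)[OF g_bd, of x j] that d'(4) by auto
      show "pd i (g j) x = darboux_rhs a b g j i x" if x: "x \<in> ball wbar d'" and ij: "i \<noteq> j" for i j x
      proof -
        have xT: "x \<in> ?T" using x d'(3) by blast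
        \<comment> \<open>\<open>beta_local_solution\<close> speaks of derivatives along coordinate
          lines; uniqueness of derivatives identifies them with \<open>pd\<close>.\<close>
        have "pd i (\<gamma>' j) x = darboux_rhs a b \<gamma>' j i x"
          using pd_has_real_derivative_line[OF \<gamma>'C1, of x 0 i j] \<gamma>'_der[of x i j] xT ij
          by (auto intro: DERIV_unique)
        moreover have "pd i (\<gamma> j) x = darboux_rhs a b \<gamma> j i x"
          using \<gamma>(2) xT ij by blast
        moreover have "pd i (g j) x = pd i (\<gamma>' j) x - pd i (\<gamma> j) x"
          unfolding g_def[abs_def] pd_def by (simp add: bderiv_diff[OF C1T xT] blinfun.diff_left)
        ultimately show ?thesis
          using E.rhs_diff[of \<gamma>' \<gamma>] by (simp add: g_def[abs_def])
      qed
      show "g j x = 0" if x: "x \<in> ball wbar d'" and ax: "\<And>i. i \<noteq> j \<Longrightarrow> x $ i = wbar $ i" for j x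
      proof -
        have xT: "x \<in> ?T" using x d'(3) by blast
        \<comment> \<open>A point of the \<open>j\<close>-line has exactly the form on which the
          data are prescribed.\<close>
        have eq: "(\<chi> k. if k = j then x $ j else wbar $ k) = x"
          using ax by (simp add: vec_eq_iff)
        have "x $ j \<in> I j" using xT ball_S' S'_I by blast
        then have "\<gamma>' j x = \<phi> j (x $ j)"
          using \<gamma>'_axis[of "x $ j" j] xT unfolding eq by simp
        moreover have "\<gamma> j x = \<phi> j (x $ j)"
          using \<gamma>(3)[of x j] ax xT by (simp add: \<Phi>_def)
        ultimately show ?thesis by (simp add: g_def)
      qed
    qed
    then show ?thesis
      using d' by (intro exI[of _ "ball wbar d'"]) (auto simp: g_def simp del: mem_ball)
  qed
  show ?thesis
  proof (rule exI[of _ "ball wbar d"], rule exI[of _ \<gamma>], intro conjI sol subset_trans[OF ball_S' S'(3)])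
    show "\<forall>V' \<gamma>'. V' \<subseteq> ?S \<and> beta_local_solution Z wbar I \<phi> V' \<gamma>' \<longrightarrow>
      (\<exists>W. open W \<and> wbar \<in> W \<and> W \<subseteq> ball wbar d \<inter> V' \<and> (\<forall>w\<in>W. \<forall>j. \<gamma>' j w = \<gamma> j w))"
      using uniq by simp
  qed
qed

end
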